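(* Let $(M,L)$ be a smooth manifold equipped with a Finsler Lagrangian $L$, with associated conic subbundle $\mathcal{A}\subseteq TM\setminus\{0\}$, and let $g$ be an auxiliary positive definite metric on $M$. Put $A(x,\dot x)=g_{ab}(x)\dot x^a\dot x^b$ and $\dot x_b=g_{bc}(x)\dot x^c$. On $\mathcal{A}$ we can write $L=\Omega A$ with $\Omega=LA^{-1}$. Let $\Gamma^a{}_{bc}=\tfrac12 g^{am}(\partial_b g_{mc}+\partial_c g_{mb}-\partial_m g_{bc})$ be the Christoffel symbols of $g$. 1. On the subbundle $\mathcal{A}$, $(M,L)$ is of Berwald type if and only if there exists a $(1,2)$-tensor field $T$ on $M$ such that $\Omega$ satisfies $$\partial_a\Omega-\Gamma^b{}_{ac}\dot x^c\,\dot\partial_b\Omega = T^b{}_{ac}\dot x^c\left(\dot\partial_b\Omega+\frac{2\dot x_b\,\Omega}{A}\right).$$ 2. The geodesic spray components of the Berwald type Finslerian geometry are given by $$G^a=\tfrac12\left(\Gamma^a{}_{bc}+T^a{}_{bc}\right)\dot x^b\dot x^c .$$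
   Context: Coordinates: local coordinates $x^a$ on the $n$-dimensional smooth manifold $M$ induce coordinates $(x,\dot x)$ on $TM$, where $(x,\dot x)$ denotes the vector $\dot x^a\partial_a|_x$. Write $\partial_a=\partial/\partial x^a$ and $\dot\partial_a=\partial/\partial\dot x^a$ for the coordinate derivatives on $TM$. The summation convention is used. Finsler Lagrangian: a continuous function $L:TM\to\mathbb{R}$ such that (i) $L(x,\lambda\dot x)=\lambda^2L(x,\dot x)$ for all $\lambda>0$; (ii) there is a conic subbundle $\mathcal{A}$ of $TM$ (closed under positive rescaling of $\dot x$), with $TM\setminus\mathcal{A}$ of measure zero, on which $L$ is smooth and the $L$-metric $g^L_{ab}(x,\dot x)=\tfrac12\dot\partial_a\dot\partial_bL(x,\dot x)$ is non-degenerate. No assumption is made on the signature of $g^L$. The inverse of $g^L_{ab}$ is denoted $g^{Lab}$. The pair $(M,L)$ is called a Finslerian geometry. Cartan non-linear connection coefficients on $\mathcal{A}$: $$N^a{}_b(x,\dot x)=\tfrac14\dot\partial_b\Big(g^{Laq}(x,\dot x)\big(\dot x^m\partial_m\dot\partial_qL(x,\dot x)-\partial_qL(x,\dot x)\big)\Big).$$ Geodesic spray components: $2G^a(x,\dot x)=N^a{}_b(x,\dot x)\dot x^b$. Berwald type: $(M,L)$ is of Berwald type if the Cartan non-linear connection coefficients are linear in $\dot x$, i.e. $N^a{}_b(x,\dot x)=\Xi^a{}_{bc}(x)\dot x^c$ for some functions $\Xi^a{}_{bc}$ of $x$ only. In part 2, $T$ is the tensor field of part 1.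
   Formalization: The tensor field T is required to be symmetric in its two lower indices in both parts; without this the "if" direction of part 1 and the formula of part 2 fail, e.g. for Finsler Lagrangians preserved by a connection with torsion. *)

theory Defs
  imports "HOL-Analysis.Analysis"
begin

section \<open>Smooth manifolds\<close>

text \<open>\<open>Ck_on k S f\<close> is meant for open \<open>S\<close>.\<close>

primrec Ck_on :: "nat \<Rightarrow> 'a::euclidean_space set \<Rightarrow> ('a \<Rightarrow> 'b::real_normed_vector) \<Rightarrow> bool" where
  "Ck_on 0 S f \<longleftrightarrow> continuous_on S f"
| "Ck_on (Suc k) S f \<longleftrightarrow>
     (\<forall>x\<in>S. f differentiable (at x)) \<and> (\<forall>v. Ck_on k S (\<lambda>x. frechet_derivative f (at x) v))"

definition smooth_on :: "'a::euclidean_space set \<Rightarrow> ('a \<Rightarrow> 'b::real_normed_vector) \<Rightarrow> bool" where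
  "smooth_on S f \<longleftrightarrow> (\<forall>k. Ck_on k S f)"

text \<open>A chart is a pair of its domain and its coordinate map; the coordinate map is arbitrary
  outside the domain. The dimension of the manifold is \<open>CARD('n)\<close>.\<close>

type_synonym ('m, 'n) chart = "'m set \<times> ('m \<Rightarrow> real^'n)"

abbreviation cdom :: "('m, 'n) chart \<Rightarrow> 'm set" where "cdom \<equiv> fst"
abbreviation cmap :: "('m, 'n) chart \<Rightarrow> 'm \<Rightarrow> real^'n" where "cmap \<equiv> snd"

definition is_chart :: "'m topology \<Rightarrow> ('m, 'n::finite) chart \<Rightarrow> bool" where
  "is_chart X c \<longleftrightarrow> openin X (cdom c) \<and> open (cmap c ` cdom c) \<and>
     homeomorphic_map (subtopology X (cdom c)) (top_of_set (cmap c ` cdom c)) (cmap c)"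

definition transition :: "('m, 'n) chart \<Rightarrow> ('m, 'n) chart \<Rightarrow> real^'n \<Rightarrow> real^'n" where
  "transition c d = cmap d \<circ> inv_into (cdom c) (cmap c)"

definition smooth_atlas :: "'m topology \<Rightarrow> ('m, 'n::finite) chart set \<Rightarrow> bool" where
  "smooth_atlas X \<U> \<longleftrightarrow>
     (\<forall>c\<in>\<U>. is_chart X c) \<and> (\<Union>c\<in>\<U>. cdom c) = topspace X \<and>
     (\<forall>c\<in>\<U>. \<forall>d\<in>\<U>. smooth_on (cmap c ` (cdom c \<inter> cdom d)) (transition c d))"

text \<open>The atlas is not required to be maximal; maximal atlases are a special case.\<close>

definition smooth_manifold :: "'m topology \<Rightarrow> ('m, 'n::finite) chart set \<Rightarrow> bool" where
  "smooth_manifold X \<U> \<longleftrightarrow> Hausdorff_space X \<and> second_countable X \<and> smooth_atlas X \<U>"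

text \<open>Entry \<open>(i, a)\<close> of \<open>jac c d p\<close> is the derivative at \<open>p\<close> of the \<open>i\<close>-th coordinate of \<open>d\<close>
  with respect to the \<open>a\<close>-th coordinate of \<open>c\<close>.\<close>

definition jac :: "('m, 'n::finite) chart \<Rightarrow> ('m, 'n) chart \<Rightarrow> 'm \<Rightarrow> real^'n^'n" where
  "jac c d p = matrix (frechet_derivative (transition c d) (at (cmap c p)))"


section \<open>The tangent bundle\<close>

text \<open>A tangent vector is a base point together with the family of its components in all
  charts around the base point, related by the Jacobians of the transition maps. Components in
  the remaining charts are set to \<open>0\<close>, so that every vector has exactly one representation.\<close>

type_synonym ('m, 'n) tvec = "'m \<times> (('m, 'n) chart \<Rightarrow> real^'n)"

definition tangent_bundle :: "('m, 'n::finite) chart set \<Rightarrow> ('m, 'n) tvec set" where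
  "tangent_bundle \<U> = {(p, v).
     p \<in> (\<Union>c\<in>\<U>. cdom c) \<and>
     (\<forall>c\<in>\<U>. \<forall>d\<in>\<U>. p \<in> cdom c \<inter> cdom d \<longrightarrow> v d = jac c d p *v v c) \<and>
     (\<forall>c. c \<notin> \<U> \<or> p \<notin> cdom c \<longrightarrow> v c = 0)}"

definition zero_section :: "('m, 'n::finite) chart set \<Rightarrow> ('m, 'n) tvec set" where
  "zero_section \<U> = {(p, v). (p, v) \<in> tangent_bundle \<U> \<and> v = (\<lambda>_. 0)}"

definition tscale :: "real \<Rightarrow> ('m, 'n::finite) tvec \<Rightarrow> ('m, 'n) tvec" where
  "tscale r = (\<lambda>(p, v). (p, \<lambda>c. r *\<^sub>R v c))"

text \<open>The chart of the tangent bundle induced by \<open>c\<close> maps \<open>tangent_over \<U> c\<close> bijectively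
  onto \<open>cmap c ` cdom c \<times> UNIV\<close>.\<close>

definition tangent_over :: "('m, 'n::finite) chart set \<Rightarrow> ('m, 'n) chart \<Rightarrow> ('m, 'n) tvec set" where
  "tangent_over \<U> c = {(p, v). (p, v) \<in> tangent_bundle \<U> \<and> p \<in> cdom c}"

definition tcoords :: "('m, 'n) chart \<Rightarrow> ('m, 'n) tvec \<Rightarrow> (real^'n) \<times> (real^'n)" where
  "tcoords c = (\<lambda>(p, v). (cmap c p, v c))"

definition local_image ::
  "('m, 'n::finite) chart set \<Rightarrow> ('m, 'n) chart \<Rightarrow> ('m, 'n) tvec set \<Rightarrow> ((real^'n) \<times> (real^'n)) set" where
  "local_image \<U> c S = tcoords c ` (S \<inter> tangent_over \<U> c)"

definition local_rep ::
  "('m, 'n::finite) chart set \<Rightarrow> ('m, 'n) chart \<Rightarrow> (('m, 'n) tvec \<Rightarrow> real) \<Rightarrow> (real^'n) \<times> (real^'n) \<Rightarrow> real" where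
  "local_rep \<U> c f = f \<circ> inv_into (tangent_over \<U> c) (tcoords c)"

text \<open>Coordinate derivatives of functions of \<open>(x, v)\<close>, and of functions of \<open>x\<close> alone.\<close>

definition pdx :: "'n \<Rightarrow> ((real^'n::finite) \<times> (real^'n) \<Rightarrow> real) \<Rightarrow> (real^'n) \<times> (real^'n) \<Rightarrow> real" where
  "pdx a f z = frechet_derivative f (at z) (axis a 1, 0)"

definition pdv :: "'n \<Rightarrow> ((real^'n::finite) \<times> (real^'n) \<Rightarrow> real) \<Rightarrow> (real^'n) \<times> (real^'n) \<Rightarrow> real" where
  "pdv a f z = frechet_derivative f (at z) (0, axis a 1)"

definition pd :: "'n \<Rightarrow> (real^'n::finite \<Rightarrow> real) \<Rightarrow> real^'n \<Rightarrow> real" where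
  "pd a f x = frechet_derivative f (at x) (axis a 1)"


section \<open>Finsler Lagrangians\<close>

definition conic_subbundle :: "('m, 'n::finite) chart set \<Rightarrow> ('m, 'n) tvec set \<Rightarrow> bool" where
  "conic_subbundle \<U> \<A> \<longleftrightarrow>
     \<A> \<subseteq> tangent_bundle \<U> \<and>
     (\<forall>c\<in>\<U>. open (local_image \<U> c \<A>)) \<and>
     (\<forall>p \<in> (\<Union>c\<in>\<U>. cdom c). \<exists>v. (p, v) \<in> \<A>) \<and>
     (\<forall>w\<in>\<A>. \<forall>r>0. tscale r w \<in> \<A>)"

definition Lmetric ::
  "((real^'n::finite) \<times> (real^'n) \<Rightarrow> real) \<Rightarrow> (real^'n) \<times> (real^'n) \<Rightarrow> real^'n^'n" where
  "Lmetric l z = (\<chi> a b. (1/2) * pdv a (pdv b l) z)"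

text \<open>Continuity on the tangent bundle is continuity in the induced charts, whose domains are
  open and cover the bundle; likewise for smoothness and null sets.\<close>

definition finsler_lagrangian ::
  "('m, 'n::finite) chart set \<Rightarrow> ('m, 'n) tvec set \<Rightarrow> (('m, 'n) tvec \<Rightarrow> real) \<Rightarrow> bool" where
  "finsler_lagrangian \<U> \<A> L \<longleftrightarrow>
     (\<forall>c\<in>\<U>. continuous_on (local_image \<U> c (tangent_bundle \<U>)) (local_rep \<U> c L)) \<and>
     (\<forall>w\<in>tangent_bundle \<U>. \<forall>r>0. L (tscale r w) = r\<^sup>2 * L w) \<and>
     conic_subbundle \<U> \<A> \<and>
     (\<forall>c\<in>\<U>. negligible (local_image \<U> c (tangent_bundle \<U> - \<A>))) \<and>
     (\<forall>c\<in>\<U>. smooth_on (local_image \<U> c \<A>) (local_rep \<U> c L)) \<and>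
     (\<forall>c\<in>\<U>. \<forall>z\<in>local_image \<U> c \<A>. invertible (Lmetric (local_rep \<U> c L) z))"

text \<open>In the next two definitions \<open>l\<close> is the coordinate expression of the Lagrangian.
  \<open>cartan_N l a b\<close> has upper index \<open>a\<close> and lower index \<open>b\<close>.\<close>

definition cartan_N ::
  "((real^'n::finite) \<times> (real^'n) \<Rightarrow> real) \<Rightarrow> 'n \<Rightarrow> 'n \<Rightarrow> (real^'n) \<times> (real^'n) \<Rightarrow> real" where
  "cartan_N l a b z = (1/4) * pdv b (\<lambda>y. \<Sum>q\<in>UNIV. matrix_inv (Lmetric l y) $ a $ q *
       ((\<Sum>m\<in>UNIV. snd y $ m * pdx m (pdv q l) y) - pdx q l y)) z"

definition spray ::
  "((real^'n::finite) \<times> (real^'n) \<Rightarrow> real) \<Rightarrow> 'n \<Rightarrow> (real^'n) \<times> (real^'n) \<Rightarrow> real" where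
  "spray l a z = (1/2) * (\<Sum>b\<in>UNIV. cartan_N l a b z * snd z $ b)"

definition berwald_type ::
  "('m, 'n::finite) chart set \<Rightarrow> ('m, 'n) tvec set \<Rightarrow> (('m, 'n) tvec \<Rightarrow> real) \<Rightarrow> bool" where
  "berwald_type \<U> \<A> L \<longleftrightarrow>
     (\<forall>c\<in>\<U>. \<exists>\<Xi> :: real^'n \<Rightarrow> 'n \<Rightarrow> 'n \<Rightarrow> 'n \<Rightarrow> real.
        \<forall>(x, v)\<in>local_image \<U> c \<A>. \<forall>a b.
          cartan_N (local_rep \<U> c L) a b (x, v) = (\<Sum>e\<in>UNIV. \<Xi> x a b e * v $ e))"


section \<open>Tensor fields, the auxiliary metric and the Berwald condition\<close>

text \<open>Tensor fields are families of component functions, one for each chart and depending on the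
  coordinates of that chart, subject to the tensorial transformation law.\<close>

definition riemannian_metric ::
  "('m, 'n::finite) chart set \<Rightarrow> (('m, 'n) chart \<Rightarrow> real^'n \<Rightarrow> real^'n^'n) \<Rightarrow> bool" where
  "riemannian_metric \<U> g \<longleftrightarrow>
     (\<forall>c\<in>\<U>. smooth_on (cmap c ` cdom c) (g c)) \<and>
     (\<forall>c\<in>\<U>. \<forall>d\<in>\<U>. \<forall>p\<in>cdom c \<inter> cdom d. \<forall>a b.
        g d (cmap d p) $ a $ b =
          (\<Sum>i\<in>UNIV. \<Sum>j\<in>UNIV. jac d c p $ i $ a * jac d c p $ j $ b * g c (cmap c p) $ i $ j)) \<and>
     (\<forall>c\<in>\<U>. \<forall>x\<in>cmap c ` cdom c.
        (\<forall>a b. g c x $ a $ b = g c x $ b $ a) \<and>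
        (\<forall>u. u \<noteq> 0 \<longrightarrow> (\<Sum>a\<in>UNIV. \<Sum>b\<in>UNIV. g c x $ a $ b * u $ a * u $ b) > 0))"

text \<open>In \<open>T c x $ b $ a $ e\<close> the index \<open>b\<close> is contravariant, and \<open>a\<close>, \<open>e\<close> are covariant.\<close>

definition tensor_field_1_2 ::
  "('m, 'n::finite) chart set \<Rightarrow> (('m, 'n) chart \<Rightarrow> real^'n \<Rightarrow> real^'n^'n^'n) \<Rightarrow> bool" where
  "tensor_field_1_2 \<U> T \<longleftrightarrow>
     (\<forall>c\<in>\<U>. smooth_on (cmap c ` cdom c) (T c)) \<and>
     (\<forall>c\<in>\<U>. \<forall>d\<in>\<U>. \<forall>p\<in>cdom c \<inter> cdom d. \<forall>b a e.
        T d (cmap d p) $ b $ a $ e =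
          (\<Sum>i\<in>UNIV. \<Sum>j\<in>UNIV. \<Sum>k\<in>UNIV.
             jac c d p $ b $ i * jac d c p $ j $ a * jac d c p $ k $ e * T c (cmap c p) $ i $ j $ k))"

text \<open>Without this symmetry, \<open>\<Gamma> + T\<close> may have torsion and the condition below no longer implies Berwald
  type: \<open>L = (sqrt (v1\<^sup>2 + exp (2 * x1) * v2\<^sup>2) + v1 / 2)\<^sup>2\<close> on the plane is preserved by a flat connection
  with torsion, but is not of Berwald type.\<close>

definition lower_symmetric ::
  "('m, 'n::finite) chart set \<Rightarrow> (('m, 'n) chart \<Rightarrow> real^'n \<Rightarrow> real^'n^'n^'n) \<Rightarrow> bool" where
  "lower_symmetric \<U> T \<longleftrightarrow>
     (\<forall>c\<in>\<U>. \<forall>x\<in>cmap c ` cdom c. \<forall>b a e. T c x $ b $ a $ e = T c x $ b $ e $ a)"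

definition christoffel :: "(real^'n::finite \<Rightarrow> real^'n^'n) \<Rightarrow> 'n \<Rightarrow> 'n \<Rightarrow> 'n \<Rightarrow> real^'n \<Rightarrow> real" where
  "christoffel h a b e x = (1/2) * (\<Sum>m\<in>UNIV. matrix_inv (h x) $ a $ m *
     (pd b (\<lambda>y. h y $ m $ e) x + pd e (\<lambda>y. h y $ m $ b) x - pd m (\<lambda>y. h y $ b $ e) x))"

definition metric_A :: "(real^'n::finite \<Rightarrow> real^'n^'n) \<Rightarrow> (real^'n) \<times> (real^'n) \<Rightarrow> real" where
  "metric_A h = (\<lambda>(x, v). \<Sum>a\<in>UNIV. \<Sum>b\<in>UNIV. h x $ a $ b * v $ a * v $ b)"

definition lowered :: "(real^'n::finite \<Rightarrow> real^'n^'n) \<Rightarrow> 'n \<Rightarrow> (real^'n) \<times> (real^'n) \<Rightarrow> real" where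
  "lowered h b = (\<lambda>(x, v). \<Sum>e\<in>UNIV. h x $ b $ e * v $ e)"

definition Omega ::
  "((real^'n::finite) \<times> (real^'n) \<Rightarrow> real) \<Rightarrow> (real^'n \<Rightarrow> real^'n^'n) \<Rightarrow> (real^'n) \<times> (real^'n) \<Rightarrow> real" where
  "Omega l h z = l z / metric_A h z"

definition berwald_condition ::
  "('m, 'n::finite) chart set \<Rightarrow> ('m, 'n) tvec set \<Rightarrow> (('m, 'n) tvec \<Rightarrow> real) \<Rightarrow>
   (('m, 'n) chart \<Rightarrow> real^'n \<Rightarrow> real^'n^'n) \<Rightarrow> (('m, 'n) chart \<Rightarrow> real^'n \<Rightarrow> real^'n^'n^'n) \<Rightarrow> bool" where
  "berwald_condition \<U> \<A> L g T \<longleftrightarrow>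
     (\<forall>c\<in>\<U>. \<forall>(x, v)\<in>local_image \<U> c \<A>. \<forall>a.
        let \<Omega> = Omega (local_rep \<U> c L) (g c) in
          pdx a \<Omega> (x, v)
            - (\<Sum>b\<in>UNIV. \<Sum>e\<in>UNIV. christoffel (g c) b a e x * v $ e * pdv b \<Omega> (x, v))
          = (\<Sum>b\<in>UNIV. \<Sum>e\<in>UNIV. T c x $ b $ a $ e * v $ e *
               (pdv b \<Omega> (x, v) + 2 * lowered (g c) b (x, v) * \<Omega> (x, v) / metric_A (g c) (x, v))))"

end

theory Submission
  imports Defs
begin

text \<open>Since \<open>A\<close> is constant along the horizontal distribution of \<open>\<Gamma>\<close>, the condition on \<open>\<Omega>\<close> says that
  \<open>L\<close> is constant along that of \<open>D = \<Gamma> + T\<close>: \<open>\<partial>\<^sub>a L = D\<^sup>b\<^sub>a\<^sub>e v\<^sup>e \<partial>L/\<partial>v\<^sup>b\<close>. Differentiating this along the fibre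
  and using the symmetry of \<open>D\<close> yields \<open>N\<^sup>a\<^sub>b = D\<^sup>a\<^sub>b\<^sub>e v\<^sup>e\<close>, so \<open>L\<close> is of Berwald type and \<open>D\<close> is unique.
  Conversely, \<open>\<partial>\<^sub>a L = N\<^sup>b\<^sub>a \<partial>L/\<partial>v\<^sup>b\<close> holds for every Lagrangian by Euler's theorem, so linear
  coefficients \<open>N\<^sup>a\<^sub>b = \<Xi>\<^sup>a\<^sub>b\<^sub>e v\<^sup>e\<close> lead to \<open>T = \<Xi> - \<Gamma>\<close>. Both \<open>\<Xi>\<close> and \<open>\<Gamma>\<close> are the unique symmetric connections
  along which \<open>L\<close> and \<open>A\<close> respectively are constant; hence both follow the affine transformation
  law of connections, and \<open>T\<close> is a tensor.\<close>

section \<open>Calculus of smooth functions\<close>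

text \<open>The definition of Berwald type supplies the coefficients \<open>\<Xi>\<close> chart by
  chart and base point by base point, with no regularity in x. Smoothness is recovered because a
  linear function on an open nonempty subset of a fibre determines its coefficients:
  \<open>\<Xi>\<close> is a fibre derivative of N, and evaluating it along a locally constant fibre
  vector gives a smooth function of x. The conic subbundle meets every fibre, so this works over
  every base point. For the same reason horizontal constancy is treated over one base point at a
  time, with the coefficients as plain numbers: identities are differentiated along a single fibre,
  which asks nothing of their dependence on x. A change of chart likewise transports a connection at
  one point, whereas the Lagrangian must be compared on an open set, since its x-derivatives enter.
  No inverse of the L-metric is ever transformed: unique solvability of a linear system replaces
  explicit inverse matrices.\<close>

lemma has_derivative_frechet:
  "f differentiable (at x) \<Longrightarrow> (f has_derivative frechet_derivative f (at x)) (at x)"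
  by (simp add: frechet_derivative_works)

lemma frechet_derivative_eqI:
  "(f has_derivative f') (at x) \<Longrightarrow> frechet_derivative f (at x) = f'"
  using frechet_derivative_at by metis

text \<open>The recursion differentiates functions whose derivative is known by a formula on
  \<open>S\<close> only. Openness of \<open>S\<close> makes the derivative at a point of
  \<open>S\<close> depend on the values in \<open>S\<close> alone, so the formula may be substituted
  at every level.\<close>

lemma Ck_on_cong:
  assumes "open S" and "\<And>x. x \<in> S \<Longrightarrow> f x = g x"
  shows "Ck_on k S f \<longleftrightarrow> Ck_on k S g"
  using assms(2)
proof (induction k arbitrary: f g)
  case 0
  then show ?case by (simp cong: continuous_on_cong)
next
  case (Suc k)
  have diff: "f differentiable (at x) \<longleftrightarrow> g differentiable (at x)" if "x \<in> S" for x
    using that Suc.prems \<open>open S\<close> unfolding differentiable_def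
    by (metis has_derivative_transform_within_open)
  show ?case
  proof (cases "\<forall>x\<in>S. f differentiable (at x)")
    case True
    have "frechet_derivative f (at x) = frechet_derivative g (at x)" if "x \<in> S" for x
      using frechet_derivative_transform_within_open[OF _ \<open>open S\<close> that] True that Suc.prems by blast
    then have "Ck_on k S (\<lambda>x. frechet_derivative f (at x) v) \<longleftrightarrow>
        Ck_on k S (\<lambda>x. frechet_derivative g (at x) v)" for v
      by (intro Suc.IH) auto
    then show ?thesis using diff by simp
  next
    case False
    then show ?thesis using diff by auto
  qed
qed

lemma Ck_on_Suc_imp: "Ck_on (Suc k) S f \<Longrightarrow> Ck_on k S f"
proof (induction k arbitrary: f)
  case 0
  then show ?case
    by (auto intro!: continuous_at_imp_continuous_on differentiable_imp_continuous_within)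
next
  case (Suc k)
  then show ?case by (metis Ck_on.simps(2))
qed

text \<open>Derivatives in \<open>Ck_on\<close> are taken in the whole space and not relative to
  \<open>S\<close>, so local statements glue without a compatibility condition. This is how
  coefficients known to be smooth only near each point become smooth on a chart image.\<close>

lemma Ck_on_local:
  assumes "\<And>x. x \<in> S \<Longrightarrow> \<exists>T. x \<in> T \<and> open T \<and> Ck_on k T f"
  shows "Ck_on k S f"
  using assms
proof (induction k arbitrary: f)
  case 0
  then show ?case
    by (metis Ck_on.simps(1) continuous_at_imp_continuous_on continuous_on_eq_continuous_at)
next
  case (Suc k)
  show ?case
    unfolding Ck_on.simps
  proof safe
    fix x assume "x \<in> S"
    then show "f differentiable at x" using Suc.prems by fastforce
  next
    fix v
    show "Ck_on k S (\<lambda>x. frechet_derivative f (at x) v)"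
      by (rule Suc.IH) (metis Suc.prems Ck_on.simps(2))
  qed
qed

section \<open>Algebra of k times continuously differentiable functions\<close>

lemma Ck_on_const: "Ck_on k S (\<lambda>x. c)"
  by (induction k arbitrary: c) auto

lemma Ck_on_add:
  assumes "open S" "Ck_on k S f" "Ck_on k S g"
  shows "Ck_on k S (\<lambda>x. f x + g x)"
  using assms(2,3)
proof (induction k arbitrary: f g)
  case 0
  then show ?case by (auto intro: continuous_on_add)
next
  case (Suc k)
  have d: "((\<lambda>x. f x + g x) has_derivative
      (\<lambda>v. frechet_derivative f (at x) v + frechet_derivative g (at x) v)) (at x)" if "x \<in> S" for x
    using that Suc.prems by (auto intro!: has_derivative_add has_derivative_frechet)
  have "Ck_on k S (\<lambda>x. frechet_derivative (\<lambda>x. f x + g x) (at x) v)" for v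
    using Ck_on_cong[OF \<open>open S\<close>, of "\<lambda>x. frechet_derivative (\<lambda>x. f x + g x) (at x) v"
        "\<lambda>x. frechet_derivative f (at x) v + frechet_derivative g (at x) v"]
      Suc.IH Suc.prems frechet_derivative_eqI[OF d] by auto
  then show ?case using d by (auto simp: differentiable_def)
qed

lemma Ck_on_bounded_linear:
  assumes h: "bounded_linear h" and "open S" "Ck_on k S f"
  shows "Ck_on k S (\<lambda>x. h (f x))"
  using assms(3)
proof (induction k arbitrary: f)
  case 0
  then show ?case by (auto intro: bounded_linear.continuous_on[OF h])
next
  case (Suc k)
  have d: "((\<lambda>x. h (f x)) has_derivative (\<lambda>v. h (frechet_derivative f (at x) v))) (at x)"
    if "x \<in> S" for x
    using that Suc.prems by (auto intro!: bounded_linear.has_derivative[OF h] has_derivative_frechet)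
  have "Ck_on k S (\<lambda>x. frechet_derivative (\<lambda>x. h (f x)) (at x) v)" for v
    using Ck_on_cong[OF \<open>open S\<close>, of "\<lambda>x. frechet_derivative (\<lambda>x. h (f x)) (at x) v"
        "\<lambda>x. h (frechet_derivative f (at x) v)"]
      Suc.IH Suc.prems frechet_derivative_eqI[OF d] by auto
  then show ?case using d by (auto simp: differentiable_def)
qed

lemma Ck_on_mult:
  fixes f g :: "'a::euclidean_space \<Rightarrow> real"
  assumes "open S" "Ck_on k S f" "Ck_on k S g"
  shows "Ck_on k S (\<lambda>x. f x * g x)"
  using assms(2,3)
proof (induction k arbitrary: f g)
  case 0
  then show ?case by (auto intro: continuous_on_mult)
next
  case (Suc k)
  have d: "((\<lambda>x. f x * g x) has_derivative
      (\<lambda>v. f x * frechet_derivative g (at x) v + frechet_derivative f (at x) v * g x)) (at x)"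
    if "x \<in> S" for x
    using that Suc.prems by (auto intro!: has_derivative_mult has_derivative_frechet)
  \<comment> \<open>The product rule also contains \<open>f\<close> and \<open>g\<close>
    undifferentiated; they enter the induction hypothesis after their order is lowered by
    one.\<close>
  have "Ck_on k S (\<lambda>x. frechet_derivative (\<lambda>x. f x * g x) (at x) v)" for v
    using Ck_on_cong[OF \<open>open S\<close>, of "\<lambda>x. frechet_derivative (\<lambda>x. f x * g x) (at x) v"
        "\<lambda>x. f x * frechet_derivative g (at x) v + frechet_derivative f (at x) v * g x"]
      Suc frechet_derivative_eqI[OF d] Ck_on_Suc_imp[OF Suc.prems(1)] Ck_on_Suc_imp[OF Suc.prems(2)]
    by (auto intro!: Ck_on_add \<open>open S\<close>)
  then show ?case using d by (auto simp: differentiable_def)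
qed

text \<open>The derivative of \<open>1/f\<close> is \<open>-(1/f) f' (1/f)\<close>, where
  \<open>1/f\<close> is needed only to the lower order covered by the induction hypothesis, so
  closure under products suffices.\<close>

lemma Ck_on_inverse:
  fixes f :: "'a::euclidean_space \<Rightarrow> real"
  assumes "open S" "Ck_on k S f" and nz: "\<And>x. x \<in> S \<Longrightarrow> f x \<noteq> 0"
  shows "Ck_on k S (\<lambda>x. inverse (f x))"
  using assms(2)
proof (induction k)
  case 0
  then show ?case using nz by (auto intro: continuous_on_inverse)
next
  case (Suc k)
  have d: "((\<lambda>x. inverse (f x)) has_derivative
      (\<lambda>v. - (inverse (f x) * frechet_derivative f (at x) v * inverse (f x)))) (at x)"
    if "x \<in> S" for x
    using that Suc.prems nz by (intro Deriv.has_derivative_inverse has_derivative_frechet) auto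
  have "Ck_on k S (\<lambda>x. inverse (f x))"
    using Suc Ck_on_Suc_imp by blast
  then have "Ck_on k S (\<lambda>x. - (inverse (f x) * frechet_derivative f (at x) v * inverse (f x)))" for v
    using Suc.prems
    by (intro Ck_on_bounded_linear[OF bounded_linear_minus[OF bounded_linear_ident]] Ck_on_mult \<open>open S\<close>) auto
  then have "Ck_on k S (\<lambda>x. frechet_derivative (\<lambda>x. inverse (f x)) (at x) v)" for v
    using Ck_on_cong[OF \<open>open S\<close>, of "\<lambda>x. frechet_derivative (\<lambda>x. inverse (f x)) (at x) v"
        "\<lambda>x. - (inverse (f x) * frechet_derivative f (at x) v * inverse (f x))"]
      frechet_derivative_eqI[OF d] by auto
  then show ?case using d by (auto simp: differentiable_def)
qed

lemma Ck_on_linear: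
  assumes "bounded_linear h" and "open S"
  shows "Ck_on k S h"
proof (cases k)
  case 0
  then show ?thesis using assms by (simp add: linear_continuous_on)
next
  case (Suc j)
  have "frechet_derivative h (at x) = h" for x
    by (intro frechet_derivative_eqI bounded_linear_imp_has_derivative assms)
  then show ?thesis
    using Suc bounded_linear_imp_differentiable[OF assms(1)] by (simp add: Ck_on_const)
qed

text \<open>An affine inner map has constant derivative, so the chain rule reproduces a function of
  the same shape and the induction closes without products. The projection to the base point and the
  slices \<open>y -> (y, v)\<close> are of this form.\<close>

lemma Ck_on_compose_affine:
  assumes h: "bounded_linear h" and "open S" "Ck_on k T f" and sub: "\<And>x. x \<in> S \<Longrightarrow> h x + c \<in> T"
  shows "Ck_on k S (\<lambda>x. f (h x + c))"
  using assms(3)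
proof (induction k arbitrary: f)
  case 0
  have "continuous_on S (f \<circ> (\<lambda>x. h x + c))"
    using 0 sub
    by (intro continuous_on_compose continuous_intros linear_continuous_on[OF h])
      (auto intro: continuous_on_subset)
  then show ?case by (simp add: o_def)
next
  case (Suc k)
  have d: "((\<lambda>x. f (h x + c)) has_derivative (\<lambda>v. frechet_derivative f (at (h x + c)) (h v))) (at x)"
    if "x \<in> S" for x
  proof (rule has_derivative_compose[where g = f and f = "\<lambda>x. h x + c"])
    show "((\<lambda>x. h x + c) has_derivative h) (at x)"
      using has_derivative_add_const[OF bounded_linear_imp_has_derivative[OF h]] .
    show "(f has_derivative frechet_derivative f (at (h x + c))) (at (h x + c))"
      using Suc.prems sub[OF that] by (auto intro: has_derivative_frechet)
  qed
  have "Ck_on k S (\<lambda>x. frechet_derivative f (at (h x + c)) (h v))" for v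
    using Suc by auto
  then have "Ck_on k S (\<lambda>x. frechet_derivative (\<lambda>x. f (h x + c)) (at x) v)" for v
    using Ck_on_cong[OF \<open>open S\<close>, of "\<lambda>x. frechet_derivative (\<lambda>x. f (h x + c)) (at x) v"
        "\<lambda>x. frechet_derivative f (at (h x + c)) (h v)"]
      frechet_derivative_eqI[OF d] by auto
  then show ?case using d by (auto simp: differentiable_def)
qed

section \<open>Algebra of smooth functions\<close>

lemma smooth_on_cong:
  "open S \<Longrightarrow> (\<And>x. x \<in> S \<Longrightarrow> f x = g x) \<Longrightarrow> smooth_on S f \<longleftrightarrow> smooth_on S g"
  unfolding smooth_on_def by (metis Ck_on_cong)

lemma smooth_on_local:
  assumes "\<And>x. x \<in> S \<Longrightarrow> \<exists>T. x \<in> T \<and> open T \<and> smooth_on T f"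
  shows "smooth_on S f"
  unfolding smooth_on_def
proof
  fix k show "Ck_on k S f"
    by (rule Ck_on_local) (metis assms smooth_on_def)
qed

lemma smooth_on_const: "smooth_on S (\<lambda>x. c)"
  by (simp add: smooth_on_def Ck_on_const)

lemma smooth_on_add:
  "open S \<Longrightarrow> smooth_on S f \<Longrightarrow> smooth_on S g \<Longrightarrow> smooth_on S (\<lambda>x. f x + g x)"
  by (simp add: smooth_on_def Ck_on_add)

lemma smooth_on_bounded_linear:
  "bounded_linear h \<Longrightarrow> open S \<Longrightarrow> smooth_on S f \<Longrightarrow> smooth_on S (\<lambda>x. h (f x))"
  by (simp add: smooth_on_def Ck_on_bounded_linear)

lemma smooth_on_linear: "bounded_linear h \<Longrightarrow> open S \<Longrightarrow> smooth_on S h"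
  by (simp add: smooth_on_def Ck_on_linear)

lemma smooth_on_minus: "open S \<Longrightarrow> smooth_on S f \<Longrightarrow> smooth_on S (\<lambda>x. - f x)"
  using smooth_on_bounded_linear[OF bounded_linear_minus[OF bounded_linear_ident]] by blast

lemma smooth_on_diff:
  "open S \<Longrightarrow> smooth_on S f \<Longrightarrow> smooth_on S g \<Longrightarrow> smooth_on S (\<lambda>x. f x - g x)"
  using smooth_on_add[of S f "\<lambda>x. - g x"] smooth_on_minus[of S g] by simp

lemma smooth_on_sum:
  "open S \<Longrightarrow> (\<And>i. i \<in> I \<Longrightarrow> smooth_on S (f i)) \<Longrightarrow> smooth_on S (\<lambda>x. \<Sum>i\<in>I. f i x)"
  by (induction I rule: infinite_finite_induct) (auto intro: smooth_on_const smooth_on_add)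

lemma smooth_on_mult:
  fixes f g :: "'a::euclidean_space \<Rightarrow> real"
  shows "open S \<Longrightarrow> smooth_on S f \<Longrightarrow> smooth_on S g \<Longrightarrow> smooth_on S (\<lambda>x. f x * g x)"
  by (simp add: smooth_on_def Ck_on_mult)

lemma smooth_on_prod:
  fixes f :: "'i \<Rightarrow> 'a::euclidean_space \<Rightarrow> real"
  shows "open S \<Longrightarrow> (\<And>i. i \<in> I \<Longrightarrow> smooth_on S (f i)) \<Longrightarrow> smooth_on S (\<lambda>x. \<Prod>i\<in>I. f i x)"
  by (induction I rule: infinite_finite_induct) (auto intro: smooth_on_const smooth_on_mult)

lemma smooth_on_divide:
  fixes f g :: "'a::euclidean_space \<Rightarrow> real"
  shows "open S \<Longrightarrow> smooth_on S f \<Longrightarrow> smooth_on S g \<Longrightarrow> (\<And>x. x \<in> S \<Longrightarrow> g x \<noteq> 0) \<Longrightarrow>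
    smooth_on S (\<lambda>x. f x / g x)"
  unfolding divide_inverse
  by (rule smooth_on_mult) (simp_all add: smooth_on_def Ck_on_inverse)

lemma smooth_on_compose_affine:
  "bounded_linear h \<Longrightarrow> open S \<Longrightarrow> smooth_on T f \<Longrightarrow> (\<And>x. x \<in> S \<Longrightarrow> h x + c \<in> T) \<Longrightarrow>
    smooth_on S (\<lambda>x. f (h x + c))"
  unfolding smooth_on_def by (blast intro: Ck_on_compose_affine)

lemma smooth_on_nth:
  "open S \<Longrightarrow> smooth_on S f \<Longrightarrow> smooth_on S (\<lambda>x. f x $ i)"
  by (rule smooth_on_bounded_linear[OF bounded_linear_vec_nth])

lemma smooth_on_vec_lambda:
  fixes f :: "'n::finite \<Rightarrow> 'a::euclidean_space \<Rightarrow> 'b::euclidean_space"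
  assumes "open S" "\<And>i. smooth_on S (f i)"
  shows "smooth_on S (\<lambda>x. \<chi> i. f i x)"
proof -
  have lin: "bounded_linear (axis i :: 'b \<Rightarrow> 'b^'n)" for i
    unfolding linear_conv_bounded_linear[symmetric]
    by (rule linearI) (auto simp: axis_def vec_eq_iff)
  have "smooth_on S (\<lambda>x. \<Sum>i\<in>UNIV. axis i (f i x))"
    by (rule smooth_on_sum[OF assms(1)]) (rule smooth_on_bounded_linear[OF lin assms])
  moreover have "(\<chi> i. f i x) = (\<Sum>i\<in>UNIV. axis i (f i x))" for x
    by (simp add: vec_eq_iff axis_def)
  ultimately show ?thesis by simp
qed

lemma smooth_on_frechet_derivative:
  "smooth_on S f \<Longrightarrow> smooth_on S (\<lambda>x. frechet_derivative f (at x) v)"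
  unfolding smooth_on_def by (metis Ck_on.simps(2))

lemma smooth_on_differentiable: "smooth_on S f \<Longrightarrow> x \<in> S \<Longrightarrow> f differentiable (at x)"
  unfolding smooth_on_def by (metis Ck_on.simps(2))

lemma smooth_on_imp_continuous_on: "smooth_on S f \<Longrightarrow> continuous_on S f"
  unfolding smooth_on_def by (metis Ck_on.simps(1))

section \<open>Smoothness of determinants and inverse matrices\<close>

lemma smooth_on_det:
  fixes M :: "'a::euclidean_space \<Rightarrow> real^'n^'n"
  assumes "open S" "\<And>i j. smooth_on S (\<lambda>x. M x $ i $ j)"
  shows "smooth_on S (\<lambda>x. det (M x))"
  unfolding det_def
  using assms by (intro smooth_on_sum smooth_on_mult smooth_on_prod smooth_on_const) auto

lemma
  fixes A :: "'a::semiring_1^'n^'m"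
  assumes "invertible A"
  shows matrix_inv_right: "A ** matrix_inv A = mat 1"
    and matrix_inv_left: "matrix_inv A ** A = mat 1"
  using someI_ex[OF assms[unfolded invertible_def]] unfolding matrix_inv_def by blast+

text \<open>Cramer's rule writes each entry of the inverse as a quotient of determinants, which are
  polynomials in the entries.\<close>

lemma smooth_on_matrix_inv:
  fixes M :: "'a::euclidean_space \<Rightarrow> real^'n^'n"
  assumes "open S" and M: "\<And>i j. smooth_on S (\<lambda>x. M x $ i $ j)"
    and inv: "\<And>x. x \<in> S \<Longrightarrow> invertible (M x)"
  shows "smooth_on S (\<lambda>x. matrix_inv (M x) $ i $ j)"
proof -
  \<comment> \<open>Column \<open>j\<close> of the inverse solves
    \<open>M x *v y = axis j 1\<close>; Cramer's rule for its entry \<open>i\<close> puts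
    \<open>axis j 1\<close> into column \<open>i\<close> of \<open>M x\<close>.\<close>
  let ?N = "\<lambda>x. \<chi> r s. if s = i then axis j 1 $ r else M x $ r $ s"
  have "matrix_inv (M x) $ i $ j = det (?N x) / det (M x)" if "x \<in> S" for x
  proof -
    have "M x ** matrix_inv (M x) = mat 1"
      using inv[OF that] matrix_inv_right by blast
    then have "M x *v (matrix_inv (M x) *v axis j 1) = axis j 1"
      by (simp add: matrix_vector_mul_assoc)
    then have "matrix_inv (M x) *v axis j 1 =
        (\<chi> k. det (\<chi> r s. if s = k then axis j 1 $ r else M x $ r $ s) / det (M x))"
      using cramer[THEN iffD1] inv[OF that] invertible_det_nz by blast
    then show ?thesis by (simp add: vec_eq_iff matrix_vector_mul_component inner_axis)
  qed
  moreover have "smooth_on S (\<lambda>x. det (?N x) / det (M x))"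
  proof (intro smooth_on_divide smooth_on_det assms)
    fix r s show "smooth_on S (\<lambda>x. ?N x $ r $ s)"
      by (cases "s = i") (auto intro: smooth_on_const M)
  qed (use inv invertible_det_nz in auto)
  ultimately show ?thesis
    using smooth_on_cong[OF \<open>open S\<close>, of "\<lambda>x. matrix_inv (M x) $ i $ j" "\<lambda>x. det (?N x) / det (M x)"]
    by blast
qed

section \<open>Symmetry of second derivatives\<close>

lemma has_real_derivative_along_line:
  fixes f :: "'a::real_normed_vector \<Rightarrow> real"
  assumes "f differentiable (at (p + s *\<^sub>R u))"
  shows "((\<lambda>s. f (p + s *\<^sub>R u)) has_real_derivative frechet_derivative f (at (p + s *\<^sub>R u)) u) (at s)"
proof -
  have "((\<lambda>s. f (p + s *\<^sub>R u)) has_derivative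
      (\<lambda>r. frechet_derivative f (at (p + s *\<^sub>R u)) (r *\<^sub>R u))) (at s)"
    by (rule has_derivative_compose[where g = f and f = "\<lambda>s. p + s *\<^sub>R u"])
      (auto intro!: derivative_eq_intros has_derivative_frechet assms)
  then show ?thesis
    unfolding has_field_derivative_def
    by (simp add: linear_cmul[OF linear_frechet_derivative[OF assms]] mult_commute_abs)
qed

text \<open>The mean value theorem is applied twice: in direction \<open>u\<close> to the increment
  of \<open>f\<close> across \<open>h *\<^sub>R v\<close>, then in direction \<open>v\<close> to the
  derivative so obtained. The bound on \<open>h\<close> keeps the whole parallelogram in the
  ball.\<close>

lemma second_difference:
  fixes f :: "'a::real_normed_vector \<Rightarrow> real"
  assumes f: "\<And>y. y \<in> ball x e \<Longrightarrow> f differentiable (at y)"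
    and f': "\<And>y. y \<in> ball x e \<Longrightarrow> (\<lambda>y. frechet_derivative f (at y) u) differentiable (at y)"
    and h: "0 < h" "h * (norm u + norm v) < e"
  shows "\<exists>y\<in>ball x e. f (x + h *\<^sub>R u + h *\<^sub>R v) - f (x + h *\<^sub>R u) - f (x + h *\<^sub>R v) + f x
    = h * h * frechet_derivative (\<lambda>y. frechet_derivative f (at y) u) (at y) v"
proof -
  let ?f' = "\<lambda>y. frechet_derivative f (at y) u"
  have in_ball: "x + s *\<^sub>R u + t *\<^sub>R v \<in> ball x e" if "0 \<le> s" "s \<le> h" "0 \<le> t" "t \<le> h" for s t
  proof -
    have "norm (s *\<^sub>R u + t *\<^sub>R v) \<le> s * norm u + t * norm v"
      using norm_triangle_ineq[of "s *\<^sub>R u" "t *\<^sub>R v"] that by simp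
    also have "\<dots> \<le> h * (norm u + norm v)"
      using that by (simp add: distrib_left mult_right_mono add_mono)
    also have "\<dots> < e" by (fact h)
    finally show ?thesis
      using norm_minus_cancel[of "s *\<^sub>R u + t *\<^sub>R v"] by (simp add: dist_norm add.assoc)
  qed
  let ?\<phi> = "\<lambda>s. f (x + h *\<^sub>R v + s *\<^sub>R u) - f (x + s *\<^sub>R u)"
  have "(?\<phi> has_real_derivative (?f' (x + h *\<^sub>R v + s *\<^sub>R u) - ?f' (x + s *\<^sub>R u))) (at s)"
    if "0 \<le> s" "s \<le> h" for s
    using in_ball[of s h] in_ball[of s 0] that h
    by (intro DERIV_diff has_real_derivative_along_line f) (auto simp: algebra_simps)
  from MVT2[OF h(1) this] obtain s where s: "0 < s" "s < h"
    and 1: "?\<phi> h - ?\<phi> 0 = h * (?f' (x + h *\<^sub>R v + s *\<^sub>R u) - ?f' (x + s *\<^sub>R u))"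
    by auto
  have "((\<lambda>t. ?f' (x + s *\<^sub>R u + t *\<^sub>R v)) has_real_derivative
      frechet_derivative ?f' (at (x + s *\<^sub>R u + t *\<^sub>R v)) v) (at t)" if "0 \<le> t" "t \<le> h" for t
    using in_ball[of s t] that s by (intro has_real_derivative_along_line f') auto
  from MVT2[OF h(1) this] obtain t where t: "0 < t" "t < h"
    and 2: "?f' (x + s *\<^sub>R u + h *\<^sub>R v) - ?f' (x + s *\<^sub>R u + 0 *\<^sub>R v)
      = h * frechet_derivative ?f' (at (x + s *\<^sub>R u + t *\<^sub>R v)) v"
    by auto
  have "f (x + h *\<^sub>R u + h *\<^sub>R v) - f (x + h *\<^sub>R u) - f (x + h *\<^sub>R v) + f x = ?\<phi> h - ?\<phi> 0"
    by (simp add: algebra_simps)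
  also have "\<dots> = h * h * frechet_derivative ?f' (at (x + s *\<^sub>R u + t *\<^sub>R v)) v"
    using 1 2 by (simp add: algebra_simps)
  finally show ?thesis using in_ball[of s t] s t by auto
qed

text \<open>The second difference is symmetric in \<open>u\<close> and \<open>v\<close>, so both
  mixed derivatives attain a common value, each at some point close to \<open>x\<close>; continuity
  carries the equality to \<open>x\<close>.\<close>

lemma frechet_derivative_commute:
  fixes f :: "'a::euclidean_space \<Rightarrow> real"
  assumes "open S" and smooth: "smooth_on S f" and "x \<in> S"
  shows "frechet_derivative (\<lambda>y. frechet_derivative f (at y) u) (at x) v
    = frechet_derivative (\<lambda>y. frechet_derivative f (at y) v) (at x) u"
proof (rule ccontr)
  define F where "F u v y = frechet_derivative (\<lambda>y. frechet_derivative f (at y) u) (at y) v" for u v y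
  assume "\<not> ?thesis"
  \<comment> \<open>Half the gap between the mixed derivatives at \<open>x\<close>: two deviations
    below it cannot bridge the gap.\<close>
  then have e: "\<bar>F u v x - F v u x\<bar> / 2 > 0" (is "?e > 0") by (simp add: F_def)
  have "smooth_on S (F u v)" for u v
    unfolding F_def by (intro smooth_on_frechet_derivative smooth)
  then have "continuous (at x) (F u v)" for u v
    using smooth_on_imp_continuous_on continuous_on_eq_continuous_at assms by blast
  then have "\<exists>r>0. \<forall>y. dist x y < r \<longrightarrow> \<bar>F u v y - F u v x\<bar> < ?e" for u v
    using e unfolding continuous_at_eps_delta by (metis dist_real_def dist_commute)
  then obtain r where r: "\<And>u v. r u v > 0" "\<And>u v y. dist x y < r u v \<Longrightarrow> \<bar>F u v y - F u v x\<bar> < ?e"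
    unfolding F_def using e by metis
  have cont: "\<exists>r>0. \<forall>y\<in>ball x r. \<bar>F u v y - F u v x\<bar> < ?e \<and> \<bar>F v u y - F v u x\<bar> < ?e"
    using r by (intro exI[of _ "min (r u v) (r v u)"]) auto
  then obtain r1 where r1: "r1 > 0"
    "\<And>y. y \<in> ball x r1 \<Longrightarrow> \<bar>F u v y - F u v x\<bar> < ?e \<and> \<bar>F v u y - F v u x\<bar> < ?e" by blast
  obtain r2 where r2: "r2 > 0" "ball x r2 \<subseteq> S" using assms(1,3) openE by blast
  define d where "d = min r1 r2"
  have d: "d > 0" "ball x d \<subseteq> ball x r1" "ball x d \<subseteq> S"
    using r1 r2 by (auto simp: d_def)
  have diff: "f differentiable (at y)" "(\<lambda>y. frechet_derivative f (at y) w) differentiable (at y)"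
    if "y \<in> ball x d" for y w
    using that d smooth smooth_on_differentiable smooth_on_frechet_derivative by (metis subsetD)+
  \<comment> \<open>The summand 1 keeps the denominator positive when \<open>u\<close> and
    \<open>v\<close> vanish and makes the bound strict.\<close>
  define h where "h = d / (norm u + norm v + 1)"
  have "norm u + norm v + 1 > 0" by (smt (verit) norm_ge_zero)
  then have h: "h > 0" "h * (norm u + norm v) < d" "h * (norm v + norm u) < d"
    using d(1) by (auto simp: h_def field_simps)
  obtain y1 where y1: "y1 \<in> ball x d"
    "f (x + h *\<^sub>R u + h *\<^sub>R v) - f (x + h *\<^sub>R u) - f (x + h *\<^sub>R v) + f x = h * h * F u v y1"
    using second_difference[OF diff h(1,2)] unfolding F_def by blast
  obtain y2 where y2: "y2 \<in> ball x d"
    "f (x + h *\<^sub>R v + h *\<^sub>R u) - f (x + h *\<^sub>R v) - f (x + h *\<^sub>R u) + f x = h * h * F v u y2"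
    using second_difference[OF diff h(1,3)] unfolding F_def by blast
  have "h * h * F u v y1 = h * h * F v u y2"
    using y1(2) y2(2) by (simp add: algebra_simps)
  then have "F u v y1 = F v u y2" using h(1) by simp
  moreover have "\<bar>F u v y1 - F u v x\<bar> < ?e" "\<bar>F v u y2 - F v u x\<bar> < ?e"
    using r1(2) y1(1) y2(1) d(2) by blast+
  ultimately show False by (simp add: abs_if split: if_splits)
qed

section \<open>Coordinate derivatives\<close>

lemma frechet_derivative_cong_open:
  assumes "open S" "smooth_on S f" "x \<in> S" "\<And>y. y \<in> S \<Longrightarrow> f y = g y"
  shows "frechet_derivative f (at x) = frechet_derivative g (at x)"
  using frechet_derivative_transform_within_open[OF smooth_on_differentiable] assms by blast

lemma frechet_derivative_sum:
  assumes "\<And>i. i \<in> I \<Longrightarrow> f i differentiable (at z)"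
  shows "frechet_derivative (\<lambda>z. \<Sum>i\<in>I. f i z) (at z) w = (\<Sum>i\<in>I. frechet_derivative (f i) (at z) w)"
proof -
  have "((\<lambda>z. \<Sum>i\<in>I. f i z) has_derivative (\<lambda>w. \<Sum>i\<in>I. frechet_derivative (f i) (at z) w)) (at z)"
    by (intro has_derivative_sum has_derivative_frechet assms)
  then show ?thesis by (simp add: frechet_derivative_eqI)
qed

lemma frechet_derivative_mult:
  fixes f g :: "'a::real_normed_vector \<Rightarrow> real"
  assumes "f differentiable (at z)" "g differentiable (at z)"
  shows "frechet_derivative (\<lambda>z. f z * g z) (at z) w
    = f z * frechet_derivative g (at z) w + frechet_derivative f (at z) w * g z"
proof -
  have "((\<lambda>z. f z * g z) has_derivative
      (\<lambda>w. f z * frechet_derivative g (at z) w + frechet_derivative f (at z) w * g z)) (at z)"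
    by (intro has_derivative_mult has_derivative_frechet assms)
  then show ?thesis by (simp add: frechet_derivative_eqI)
qed

lemma frechet_derivative_snd_nth:
  "frechet_derivative (\<lambda>z. snd z $ i) (at z) w = snd w $ i"
  by (simp add: frechet_derivative_eqI[OF bounded_linear_imp_has_derivative]
      bounded_linear_compose[OF bounded_linear_vec_nth bounded_linear_snd])

lemma differentiable_snd_nth: "(\<lambda>z. snd z $ i) differentiable (at z)"
  by (rule bounded_linear_imp_differentiable[OF bounded_linear_compose[OF bounded_linear_vec_nth bounded_linear_snd]])

lemma smooth_on_snd_nth:
  fixes U :: "('a::euclidean_space \<times> (real^'n)) set"
  shows "open U \<Longrightarrow> smooth_on U (\<lambda>z. snd z $ i)"
  by (intro smooth_on_linear bounded_linear_compose[OF bounded_linear_vec_nth bounded_linear_snd])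

lemma smooth_on_pdx: "smooth_on U f \<Longrightarrow> smooth_on U (pdx a f)"
  and smooth_on_pdv: "smooth_on U f \<Longrightarrow> smooth_on U (pdv a f)"
  and smooth_on_pd: "smooth_on V h \<Longrightarrow> smooth_on V (pd a h)"
  unfolding pdx_def[abs_def] pdv_def[abs_def] pd_def[abs_def]
  by (rule smooth_on_frechet_derivative, assumption)+

lemma pdv_commute:
  "open U \<Longrightarrow> smooth_on U f \<Longrightarrow> z \<in> U \<Longrightarrow> pdv a (pdv b f) z = pdv b (pdv a f) z"
  and pdv_pdx_commute:
  "open U \<Longrightarrow> smooth_on U f \<Longrightarrow> z \<in> U \<Longrightarrow> pdv a (pdx b f) z = pdx b (pdv a f) z"
  unfolding pdx_def[abs_def] pdv_def[abs_def]
  by (rule frechet_derivative_commute, assumption+)+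

section \<open>Derivatives along a single fibre\<close>

lemma open_fibre:
  fixes U :: "('a::topological_space \<times> 'b::topological_space) set"
  assumes "open U"
  shows "open {v. (x, v) \<in> U}"
proof -
  have "open ((\<lambda>v. (x, v)) -` U)"
    using assms by (intro open_vimage continuous_intros)
  then show ?thesis by (simp add: vimage_def)
qed

text \<open>Connection coefficients are given at one base point, so the identities to be
  differentiated hold on one fibre and not on an open set of the total space. Hence both sides are
  assumed differentiable, and only the vertical parts of their derivatives are compared.\<close>

lemma pdv_cong_fibre:
  fixes f g :: "(real^'n::finite) \<times> (real^'n) \<Rightarrow> real"
  assumes "open U" "(x, v) \<in> U" "f differentiable (at (x, v))" "g differentiable (at (x, v))"
    and eq: "\<And>u. (x, u) \<in> U \<Longrightarrow> f (x, u) = g (x, u)"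
  shows "pdv b f (x, v) = pdv b g (x, v)"
proof -
  have d: "((\<lambda>u. h (x, u)) has_derivative (\<lambda>w. frechet_derivative h (at (x, v)) (0, w))) (at v)"
    if "h differentiable (at (x, v))" for h :: "(real^'n) \<times> (real^'n) \<Rightarrow> real"
    by (rule has_derivative_compose[where g = h and f = "\<lambda>u. (x, u)"])
      (auto intro!: derivative_eq_intros has_derivative_frechet that)
  have "((\<lambda>u. g (x, u)) has_derivative (\<lambda>w. frechet_derivative f (at (x, v)) (0, w))) (at v)"
    by (rule has_derivative_transform_within_open[OF d[OF assms(3)] open_fibre[OF assms(1)]])
      (use assms in auto)
  then have "(\<lambda>w. frechet_derivative f (at (x, v)) (0, w)) = (\<lambda>w. frechet_derivative g (at (x, v)) (0, w))"
    by (rule has_derivative_unique[OF _ d[OF assms(4)]])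
  then show ?thesis unfolding pdv_def by metis
qed

lemma sum_axis_right:
  fixes f :: "'n::finite \<Rightarrow> real"
  shows "(\<Sum>e\<in>UNIV. f e * axis q 1 $ e) = f q" "(\<Sum>e\<in>UNIV. f e * axis q r $ e * g e) = f q * r * g q"
proof -
  show *: "(\<Sum>e\<in>UNIV. f e * axis q r $ e * g e) = f q * r * g q" for r g
  proof -
    have "(\<Sum>e\<in>UNIV. f e * axis q r $ e * g e) = (\<Sum>e\<in>UNIV. if e = q then f q * r * g q else 0)"
      by (rule sum.cong) (auto simp: axis_def)
    then show ?thesis by simp
  qed
  show "(\<Sum>e\<in>UNIV. f e * axis q 1 $ e) = f q"
    using *[of 1 "\<lambda>_. 1"] by simp
qed

lemma pdv_linear_form:
  fixes c :: "'n::finite \<Rightarrow> real"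
  shows "pdv q (\<lambda>z. \<Sum>e\<in>UNIV. c e * snd z $ e) z = c q"
  unfolding pdv_def
  by (subst frechet_derivative_sum)
    (simp_all add: frechet_derivative_mult differentiable_snd_nth frechet_derivative_snd_nth sum_axis_right)

lemma pdv_quadratic_form:
  fixes c :: "'n::finite \<Rightarrow> 'n \<Rightarrow> real"
  shows "pdv q (\<lambda>z. \<Sum>a\<in>UNIV. \<Sum>b\<in>UNIV. c a b * snd z $ a * snd z $ b) z
    = (\<Sum>e\<in>UNIV. (c q e + c e q) * snd z $ e)"
proof -
  have "pdv q (\<lambda>z. \<Sum>a\<in>UNIV. \<Sum>b\<in>UNIV. c a b * snd z $ a * snd z $ b) z
    = (\<Sum>a\<in>UNIV. \<Sum>b\<in>UNIV. c a b * snd z $ a * axis q 1 $ b + c a b * axis q 1 $ a * snd z $ b)"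
    unfolding pdv_def
    by (subst frechet_derivative_sum)
      (simp_all add: frechet_derivative_sum frechet_derivative_mult differentiable_snd_nth
        frechet_derivative_snd_nth)
  also have "\<dots> = (\<Sum>a\<in>UNIV. c a q * snd z $ a) + (\<Sum>a\<in>UNIV. \<Sum>b\<in>UNIV. c a b * axis q 1 $ a * snd z $ b)"
    by (simp add: sum.distrib sum_axis_right)
  also have "(\<Sum>a\<in>UNIV. \<Sum>b\<in>UNIV. c a b * axis q 1 $ a * snd z $ b) = (\<Sum>b\<in>UNIV. c q b * snd z $ b)"
    by (subst sum.swap) (simp add: sum_axis_right)
  finally show ?thesis by (simp add: sum.distrib distrib_right)
qed

section \<open>The Cartan connection in a chart\<close>

text \<open>The difference of the two sides is the derivative of \<open>f\<close> along the
  horizontal lift of a coordinate vector. \<open>D\<close> holds the coefficients at a single base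
  point, so nothing is demanded of how they vary.\<close>

definition horizontally_constant ::
  "('n \<Rightarrow> 'n \<Rightarrow> 'n \<Rightarrow> real) \<Rightarrow> ((real^'n::finite) \<times> (real^'n) \<Rightarrow> real) \<Rightarrow> (real^'n) \<times> (real^'n) \<Rightarrow> bool" where
  "horizontally_constant D f z \<longleftrightarrow>
     (\<forall>a. pdx a f z = (\<Sum>b\<in>UNIV. \<Sum>e\<in>UNIV. D b a e * snd z $ e * pdv b f z))"

text \<open>Serves both for \<open>L\<close> on the chart image of \<open>\<A>\<close> and for the
  quadratic Lagrangian \<open>A\<close> of the auxiliary metric. Homogeneity is a hypothesis of the
  one lemma that rests on Euler's theorem.\<close>

locale chart_lagrangian =
  fixes l :: "(real^'n::finite) \<times> (real^'n) \<Rightarrow> real" and U :: "((real^'n) \<times> (real^'n)) set"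
  assumes open_U: "open U" and smooth: "smooth_on U l"
    and nondegenerate: "z \<in> U \<Longrightarrow> invertible (Lmetric l z)"
begin

text \<open>The Euler-Lagrange expression of \<open>l\<close> without its acceleration term.\<close>

definition S where "S q z = (\<Sum>m\<in>UNIV. snd z $ m * pdx m (pdv q l) z) - pdx q l z"

text \<open>This is \<open>4 G\<^sup>a\<close> for the geodesic spray \<open>G\<close>.\<close>

definition G where "G a z = (\<Sum>q\<in>UNIV. matrix_inv (Lmetric l z) $ a $ q * S q z)"

lemma cartan_N_eq: "cartan_N l a b z = (1/4) * pdv b (G a) z"
  by (simp add: cartan_N_def G_def[abs_def] S_def)

lemma smooth_S: "smooth_on U (S q)"
  unfolding S_def[abs_def]
  by (intro smooth_on_diff smooth_on_sum smooth_on_mult smooth_on_snd_nth smooth_on_pdx smooth_on_pdv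
      smooth open_U)

lemma smooth_G: "smooth_on U (G a)"
proof -
  have "smooth_on U (\<lambda>z. Lmetric l z $ i $ j)" for i j
    unfolding Lmetric_def
    by (simp, intro smooth_on_divide smooth_on_const smooth_on_pdv smooth open_U) auto
  then show ?thesis
    unfolding G_def[abs_def]
    by (intro smooth_on_sum smooth_on_mult smooth_S smooth_on_matrix_inv nondegenerate open_U)
qed

lemma smooth_cartan_N: "smooth_on U (cartan_N l a b)"
  unfolding cartan_N_eq[abs_def]
  by (intro smooth_on_mult smooth_on_const smooth_on_pdv smooth_G open_U)

lemma hessian_commute: "z \<in> U \<Longrightarrow> pdv a (pdv b l) z = pdv b (pdv a l) z"
  by (rule pdv_commute[OF open_U smooth])

text \<open>The factor 2 arises because the fibre Hessian is twice the L-metric.\<close>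

lemma hessian_G:
  assumes "z \<in> U"
  shows "(\<Sum>b\<in>UNIV. pdv q (pdv b l) z * G b z) = 2 * S q z"
proof -
  let ?M = "Lmetric l z" and ?s = "\<chi> q. S q z"
  have G: "(\<chi> a. G a z) = matrix_inv ?M *v ?s"
    by (simp add: vec_eq_iff matrix_vector_mult_def G_def)
  have "?M *v (\<chi> a. G a z) = ?s"
    unfolding G matrix_vector_mul_assoc matrix_inv_right[OF nondegenerate[OF assms]] by simp
  then have "(\<Sum>b\<in>UNIV. ?M $ q $ b * G b z) = S q z"
    by (simp add: vec_eq_iff matrix_vector_mult_def)
  then show ?thesis
    by (simp add: Lmetric_def sum_divide_distrib[symmetric] sum_distrib_left[symmetric])
qed

text \<open>Nondegeneracy makes the linear system for \<open>G\<close> uniquely solvable, so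
  \<open>G\<close> can be found by checking a candidate instead of computing an inverse
  matrix.\<close>

lemma G_eqI:
  assumes "z \<in> U" and w: "\<And>q. (\<Sum>b\<in>UNIV. pdv q (pdv b l) z * w b) = 2 * S q z"
  shows "G a z = w a"
proof -
  let ?M = "Lmetric l z"
  have "?M *v (\<chi> a. w a) = (\<chi> q. S q z)"
    using w by (simp add: vec_eq_iff matrix_vector_mult_def Lmetric_def
        sum_divide_distrib[symmetric] sum_distrib_left[symmetric])
  then have "matrix_inv ?M *v (\<chi> q. S q z) = (matrix_inv ?M ** ?M) *v (\<chi> a. w a)"
    by (simp add: matrix_vector_mul_assoc[symmetric])
  also have "\<dots> = (\<chi> a. w a)"
    by (simp add: matrix_inv_left[OF nondegenerate[OF assms(1)]])
  finally show ?thesis by (simp add: vec_eq_iff matrix_vector_mult_def G_def)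
qed

text \<open>The fibre derivative of the condition, contracted with the velocity, has two terms. By
  the symmetry of \<open>D\<close> the one in which \<open>v^e\<close> was differentiated is again a
  right-hand side of the condition, so it equals \<open>pdx q l\<close> and cancels the last term of
  \<open>S q\<close>. What remains is the fibre Hessian applied to \<open>D^b_me v^m v^e\<close>,
  and nondegeneracy identifies \<open>G\<close>.\<close>

lemma cartan_N_of_horizontally_constant:
  assumes sym: "\<And>a b e. D a b e = D a e b"
    and hc: "\<And>u. (x, u) \<in> U \<Longrightarrow> horizontally_constant D l (x, u)"
    and xv: "(x, v) \<in> U"
  shows "cartan_N l a b (x, v) = (\<Sum>e\<in>UNIV. D a b e * v $ e)"
proof -
  have diff: "pdx m l differentiable (at (x, u))" "pdv m l differentiable (at (x, u))"
    if "(x, u) \<in> U" for m u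
    using smooth_on_differentiable[OF _ that] smooth_on_pdx[OF smooth] smooth_on_pdv[OF smooth] by blast+
  have pdv_pdx: "pdv q (pdx m l) (x, u) = (\<Sum>b\<in>UNIV. D b m q * pdv b l (x, u))
      + (\<Sum>b\<in>UNIV. \<Sum>e\<in>UNIV. D b m e * u $ e * pdv q (pdv b l) (x, u))"
    if u: "(x, u) \<in> U" for q m u
  proof -
    let ?f = "\<lambda>z. \<Sum>b\<in>UNIV. \<Sum>e\<in>UNIV. D b m e * snd z $ e * pdv b l z"
    have "smooth_on U ?f"
      by (intro smooth_on_sum smooth_on_mult smooth_on_const smooth_on_snd_nth smooth_on_pdv smooth open_U)
    then have "pdv q (pdx m l) (x, u) = pdv q ?f (x, u)"
      using u hc
      by (intro pdv_cong_fibre[OF open_U u] diff) (auto simp: horizontally_constant_def intro: smooth_on_differentiable)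
    also have "\<dots> = (\<Sum>b\<in>UNIV. \<Sum>e\<in>UNIV. D b m e * u $ e * pdv q (pdv b l) (x, u)
        + D b m e * axis q 1 $ e * pdv b l (x, u))"
      unfolding pdv_def[of q]
      by (subst frechet_derivative_sum)
        (simp_all add: frechet_derivative_sum frechet_derivative_mult differentiable_snd_nth
          frechet_derivative_snd_nth diff[OF u])
    also have "\<dots> = (\<Sum>b\<in>UNIV. D b m q * pdv b l (x, u))
      + (\<Sum>b\<in>UNIV. \<Sum>e\<in>UNIV. D b m e * u $ e * pdv q (pdv b l) (x, u))"
      by (simp add: sum.distrib sum_axis_right)
    finally show ?thesis .
  qed
  \<comment> \<open>The 2 matches the \<open>2 * S q\<close> required by \<open>G_eqI\<close>. The
    fibre derivative doubles it by symmetry, and the factor 1/4 in \<open>cartan_N\<close> removes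
    both.\<close>
  let ?Q = "\<lambda>a z. \<Sum>m\<in>UNIV. \<Sum>e\<in>UNIV. 2 * D a m e * snd z $ m * snd z $ e"
  have G: "G a (x, u) = ?Q a (x, u)" if u: "(x, u) \<in> U" for a u
  proof (rule G_eqI[OF u])
    fix q
    have "(\<Sum>m\<in>UNIV. u $ m * pdx m (pdv q l) (x, u))
        = (\<Sum>m\<in>UNIV. \<Sum>b\<in>UNIV. u $ m * D b m q * pdv b l (x, u))
        + (\<Sum>m\<in>UNIV. \<Sum>b\<in>UNIV. \<Sum>e\<in>UNIV. u $ m * D b m e * u $ e * pdv q (pdv b l) (x, u))"
      by (simp add: pdv_pdx_commute[OF open_U smooth u, symmetric] pdv_pdx[OF u]
          distrib_left sum.distrib sum_distrib_left mult.assoc)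
    moreover have "(\<Sum>m\<in>UNIV. \<Sum>b\<in>UNIV. u $ m * D b m q * pdv b l (x, u)) = pdx q l (x, u)"
      using hc[OF u] by (subst sum.swap) (simp add: horizontally_constant_def sym[of _ _ q] mult_ac)
    ultimately have "S q (x, u)
        = (\<Sum>m\<in>UNIV. \<Sum>b\<in>UNIV. \<Sum>e\<in>UNIV. u $ m * D b m e * u $ e * pdv q (pdv b l) (x, u))"
      by (simp add: S_def)
    also have "\<dots> = (\<Sum>b\<in>UNIV. \<Sum>m\<in>UNIV. \<Sum>e\<in>UNIV. u $ m * D b m e * u $ e * pdv q (pdv b l) (x, u))"
      by (rule sum.swap)
    finally show "(\<Sum>b\<in>UNIV. pdv q (pdv b l) (x, u) * ?Q b (x, u)) = 2 * S q (x, u)"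
      by (simp add: sum_distrib_left mult_ac)
  qed
  have "smooth_on U (?Q a)"
    by (intro smooth_on_sum smooth_on_mult smooth_on_const smooth_on_snd_nth open_U)
  then have "pdv b (G a) (x, v) = pdv b (?Q a) (x, v)"
    using xv G smooth_G by (intro pdv_cong_fibre[OF open_U xv]) (auto intro: smooth_on_differentiable)
  also have "\<dots> = (\<Sum>e\<in>UNIV. (2 * D a b e + 2 * D a e b) * v $ e)"
    by (simp add: pdv_quadratic_form)
  also have "\<dots> = (\<Sum>e\<in>UNIV. 4 * (D a b e * v $ e))"
    by (simp add: sym[of _ _ b] mult.assoc)
  finally show ?thesis
    by (simp add: cartan_N_eq sum_distrib_left[symmetric])
qed

text \<open>A fibre of the open set \<open>U\<close> is open, so a linear function on it can be
  differentiated to read off its coefficients. The formula also exhibits \<open>\<Xi>\<close>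
  through a smooth function.\<close>

lemma linear_cartan_N_coefficients:
  assumes "\<And>u. (x, u) \<in> U \<Longrightarrow> cartan_N l a b (x, u) = (\<Sum>e\<in>UNIV. \<Xi> e * u $ e)"
    and xv: "(x, v) \<in> U"
  shows "\<Xi> e = pdv e (cartan_N l a b) (x, v)"
proof -
  have "smooth_on U (\<lambda>z. \<Sum>e\<in>UNIV. \<Xi> e * snd z $ e)"
    by (intro smooth_on_sum smooth_on_mult smooth_on_const smooth_on_snd_nth open_U)
  then have "pdv e (cartan_N l a b) (x, v) = pdv e (\<lambda>z. \<Sum>e\<in>UNIV. \<Xi> e * snd z $ e) (x, v)"
    using assms smooth_cartan_N
    by (intro pdv_cong_fibre[OF open_U xv]) (auto intro: smooth_on_differentiable)
  then show ?thesis by (simp add: pdv_linear_form)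
qed

text \<open>\<open>N^a_b\<close> is a quarter of a fibre derivative of \<open>G a\<close>, so its
  linear coefficients are second fibre derivatives of one function.\<close>

lemma linear_cartan_N_symmetric:
  assumes lin: "\<And>u a b. (x, u) \<in> U \<Longrightarrow> cartan_N l a b (x, u) = (\<Sum>e\<in>UNIV. \<Xi> a b e * u $ e)"
    and xv: "(x, v) \<in> U"
  shows "\<Xi> a b e = \<Xi> a e b"
proof -
  have "\<Xi> a b e = (1/4) * pdv e (pdv b (G a)) (x, v)" for b e
  proof -
    have "\<Xi> a b e = pdv e (cartan_N l a b) (x, v)"
      by (rule linear_cartan_N_coefficients[OF lin xv])
    also have "\<dots> = (1/4) * pdv e (pdv b (G a)) (x, v)"
      unfolding cartan_N_eq[abs_def] pdv_def[of e]
      using smooth_on_differentiable[OF smooth_on_pdv[OF smooth_G] xv]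
      by (subst frechet_derivative_mult) simp_all
    finally show ?thesis .
  qed
  then show ?thesis using pdv_commute[OF open_U smooth_G xv] by metis
qed

text \<open>Both connections are the linear coefficients of the same \<open>cartan_N\<close>. This
  rigidity is the source of all transformation laws below.\<close>

lemma horizontally_constant_unique:
  assumes "\<And>a b e. D a b e = D a e b" "\<And>a b e. D' a b e = D' a e b"
    and "\<And>u. (x, u) \<in> U \<Longrightarrow> horizontally_constant D l (x, u)"
    and "\<And>u. (x, u) \<in> U \<Longrightarrow> horizontally_constant D' l (x, u)"
    and "(x, v) \<in> U"
  shows "D a b e = D' a b e"
  using linear_cartan_N_coefficients[OF cartan_N_of_horizontally_constant[OF assms(1,3)] assms(5)]
    linear_cartan_N_coefficients[OF cartan_N_of_horizontally_constant[OF assms(2,4)] assms(5)]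
  by simp

text \<open>Euler's theorem reduces the contraction of the spray equation with the velocity to
  \<open>pdv b l * G b = 2 * v^m * pdx m l\<close>, summed over \<open>b\<close> and
  \<open>m\<close>. One more fibre derivative brings in the fibre Hessian applied to
  \<open>G\<close>, which is \<open>2 * S q\<close>; the mixed derivatives cancel and
  \<open>4 * pdx q l\<close> is left. Linearity of \<open>N\<close> is inserted only at the
  end.\<close>

lemma horizontally_constant_of_linear_cartan_N:
  assumes hom: "\<And>x v r. (x, v) \<in> U \<Longrightarrow> r > 0 \<Longrightarrow> l (x, r *\<^sub>R v) = r\<^sup>2 * l (x, v)"
    and lin: "\<And>a b. cartan_N l a b (x, v) = (\<Sum>e\<in>UNIV. \<Xi> a b e * v $ e)"
    and xv: "(x, v) \<in> U"
  shows "horizontally_constant \<Xi> l (x, v)"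
proof -
  have diff: "pdx m l differentiable (at z)" "pdv m l differentiable (at z)" "G m differentiable (at z)"
    "l differentiable (at z)" if "z \<in> U" for m z
    using smooth_on_differentiable[OF _ that] smooth_on_pdx[OF smooth] smooth_on_pdv[OF smooth] smooth_G smooth
    by blast+
  have euler: "(\<Sum>q\<in>UNIV. snd z $ q * pdv q l z) = 2 * l z" if z: "z \<in> U" for z
  proof -
    obtain y u where yu: "z = (y, u)" by fastforce
    have lin': "linear (frechet_derivative l (at z))"
      by (rule linear_frechet_derivative[OF diff(4)[OF z]])
    \<comment> \<open>The derivative at \<open>r = 1\<close> along the ray through \<open>u\<close>
      is computed by the chain rule and by homogeneity; the latter holds for positive
      \<open>r\<close>, a neighbourhood of 1.\<close>
    have "((\<lambda>r. l (y, r *\<^sub>R u)) has_derivative (\<lambda>r. frechet_derivative l (at z) (0, r *\<^sub>R u))) (at 1)"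
      by (rule has_derivative_compose[where g = l and f = "\<lambda>r. (y, r *\<^sub>R u)"])
        (use yu in \<open>auto intro!: derivative_eq_intros has_derivative_frechet diff\<close>, use z yu in simp)
    moreover have "((\<lambda>r. l (y, r *\<^sub>R u)) has_derivative (\<lambda>r. 2 * r * l z)) (at 1)"
    proof (rule has_derivative_transform_within_open[where s = "{0<..}"])
      show "((\<lambda>r. r\<^sup>2 * l z) has_derivative (\<lambda>r. 2 * r * l z)) (at 1)"
        by (auto intro!: derivative_eq_intros)
    qed (use hom z yu in auto)
    ultimately have "frechet_derivative l (at z) (0, u) = 2 * l z"
      by (metis (no_types, lifting) has_derivative_unique scaleR_one mult.right_neutral)
    moreover have "(0, u) = (\<Sum>q\<in>UNIV. u $ q *\<^sub>R (0, axis q 1))" (is "_ = ?r")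
      using basis_expansion[of u]
      by (simp add: prod_eq_iff fst_sum snd_sum scalar_mult_eq_scaleR)
    then have "frechet_derivative l (at z) (0, u) = frechet_derivative l (at z) ?r" by (rule arg_cong)
    then have "frechet_derivative l (at z) (0, u) = (\<Sum>q\<in>UNIV. u $ q * pdv q l z)"
      by (simp add: pdv_def linear_sum[OF lin'] linear_cmul[OF lin'] del: scaleR_Pair)
    ultimately show ?thesis using yu by simp
  qed
  \<comment> \<open>Euler's identity holds on the open set \<open>U\<close>, so it can be
    differentiated in every direction of the total space. Horizontal and vertical coordinate
    directions give \<open>euler_x\<close> and \<open>euler_v\<close>.\<close>
  have D_euler: "(\<Sum>q\<in>UNIV. snd z $ q * frechet_derivative (pdv q l) (at z) w + snd w $ q * pdv q l z)
      = 2 * frechet_derivative l (at z) w" if z: "z \<in> U" for z w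
  proof -
    have "frechet_derivative (\<lambda>z. \<Sum>q\<in>UNIV. snd z $ q * pdv q l z) (at z)
        = frechet_derivative (\<lambda>z. 2 * l z) (at z)"
    proof (rule frechet_derivative_cong_open[OF open_U _ z])
      show "smooth_on U (\<lambda>z. \<Sum>q\<in>UNIV. snd z $ q * pdv q l z)"
        by (intro smooth_on_sum smooth_on_mult smooth_on_snd_nth smooth_on_pdv smooth open_U)
    qed (rule euler)
    then have "frechet_derivative (\<lambda>z. \<Sum>q\<in>UNIV. snd z $ q * pdv q l z) (at z) w
        = frechet_derivative (\<lambda>z. 2 * l z) (at z) w" by simp
    then show ?thesis
      by (simp add: frechet_derivative_sum frechet_derivative_mult differentiable_mult
          differentiable_snd_nth diff[OF z] frechet_derivative_snd_nth)
  qed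
  have euler_x: "(\<Sum>q\<in>UNIV. snd z $ q * pdx m (pdv q l) z) = 2 * pdx m l z" if z: "z \<in> U" for z m
    using D_euler[OF z, of "(axis m 1, 0)"] by (simp add: pdx_def)
  have euler_v: "(\<Sum>q\<in>UNIV. snd z $ q * pdv q (pdv m l) z) = pdv m l z" if z: "z \<in> U" for z m
  proof -
    have "(\<Sum>q\<in>UNIV. snd z $ q * pdv m (pdv q l) z) + pdv m l z = 2 * pdv m l z"
      using D_euler[OF z, of "(0, axis m 1)"]
      by (simp add: pdv_def[of m] sum.distrib sum_axis_right mult.commute[of "axis _ _ $ _"])
    then show ?thesis using hessian_commute[OF z] by simp
  qed
  \<comment> \<open>In \<open>hessian_G\<close> contracted with the velocity, the Hessian reduces to
    \<open>pdv b l\<close> by \<open>euler_v\<close>. On the other side \<open>euler_x\<close>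
    contributes two copies of \<open>v^m * pdx m l\<close>, and the subtracted term of
    \<open>S\<close> takes one away.\<close>
  have contracted: "(\<Sum>b\<in>UNIV. pdv b l z * G b z) = 2 * (\<Sum>m\<in>UNIV. snd z $ m * pdx m l z)"
    if z: "z \<in> U" for z
  proof -
    have "(\<Sum>q\<in>UNIV. snd z $ q * (2 * S q z)) = (\<Sum>q\<in>UNIV. \<Sum>b\<in>UNIV. snd z $ q * pdv q (pdv b l) z * G b z)"
      by (simp add: hessian_G[OF z, symmetric] sum_distrib_left mult.assoc)
    also have "\<dots> = (\<Sum>b\<in>UNIV. \<Sum>q\<in>UNIV. snd z $ q * pdv q (pdv b l) z * G b z)"
      by (rule sum.swap)
    also have "\<dots> = (\<Sum>b\<in>UNIV. pdv b l z * G b z)"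
      by (simp add: sum_distrib_right[symmetric] euler_v[OF z])
    finally have "(\<Sum>b\<in>UNIV. pdv b l z * G b z) = 2 * (\<Sum>q\<in>UNIV. snd z $ q * S q z)"
      by (simp add: sum_distrib_left mult_ac)
    also have "(\<Sum>q\<in>UNIV. snd z $ q * S q z)
        = (\<Sum>q\<in>UNIV. \<Sum>m\<in>UNIV. snd z $ q * snd z $ m * pdx m (pdv q l) z) - (\<Sum>q\<in>UNIV. snd z $ q * pdx q l z)"
      by (simp add: S_def right_diff_distrib sum_subtractf sum_distrib_left mult.assoc)
    also have "(\<Sum>q\<in>UNIV. \<Sum>m\<in>UNIV. snd z $ q * snd z $ m * pdx m (pdv q l) z)
        = (\<Sum>m\<in>UNIV. \<Sum>q\<in>UNIV. snd z $ m * (snd z $ q * pdx m (pdv q l) z))"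
      by (subst sum.swap) (simp add: mult_ac)
    also have "\<dots> = 2 * (\<Sum>m\<in>UNIV. snd z $ m * pdx m l z)"
      by (simp add: sum_distrib_left[symmetric] euler_x[OF z]) (simp add: sum_distrib_left mult_ac)
    finally show ?thesis by simp
  qed
  have "pdx q l z = (\<Sum>b\<in>UNIV. cartan_N l b q z * pdv b l z)" if z: "z \<in> U" for q z
  proof -
    have "frechet_derivative (\<lambda>z. \<Sum>b\<in>UNIV. pdv b l z * G b z) (at z)
        = frechet_derivative (\<lambda>z. 2 * (\<Sum>m\<in>UNIV. snd z $ m * pdx m l z)) (at z)"
    proof (rule frechet_derivative_cong_open[OF open_U _ z])
      show "smooth_on U (\<lambda>z. \<Sum>b\<in>UNIV. pdv b l z * G b z)"
        by (intro smooth_on_sum smooth_on_mult smooth_G smooth_on_pdv smooth open_U)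
    qed (rule contracted)
    then have "frechet_derivative (\<lambda>z. \<Sum>b\<in>UNIV. pdv b l z * G b z) (at z) (0, axis q 1)
        = frechet_derivative (\<lambda>z. 2 * (\<Sum>m\<in>UNIV. snd z $ m * pdx m l z)) (at z) (0, axis q 1)" by simp
    then have "(\<Sum>b\<in>UNIV. pdv b l z * pdv q (G b) z) + (\<Sum>b\<in>UNIV. pdv q (pdv b l) z * G b z)
        = 2 * ((\<Sum>m\<in>UNIV. snd z $ m * pdv q (pdx m l) z) + pdx q l z)"
      by (simp add: frechet_derivative_sum frechet_derivative_mult differentiable_mult differentiable_sum
          differentiable_snd_nth diff[OF z] frechet_derivative_snd_nth pdv_def[of q] sum.distrib
          sum_axis_right mult.commute[of "axis _ _ $ _"])
    then have "(\<Sum>b\<in>UNIV. pdv b l z * pdv q (G b) z) = 4 * pdx q l z"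
      by (simp add: hessian_G[OF z] S_def pdv_pdx_commute[OF open_U smooth z])
    then show ?thesis
      by (simp add: cartan_N_eq sum_distrib_left[symmetric] mult.commute[of "pdv q (G _) z"]
          sum_divide_distrib[symmetric])
  qed
  from this[OF xv] show ?thesis
    by (simp add: horizontally_constant_def lin sum_distrib_right)
qed

end

section \<open>The auxiliary metric in a chart\<close>

lemma frechet_derivative_comp_fst:
  assumes "f differentiable (at (fst z))"
  shows "frechet_derivative (\<lambda>z. f (fst z)) (at z) w = frechet_derivative f (at (fst z)) (fst w)"
proof -
  have "((\<lambda>z. f (fst z)) has_derivative (\<lambda>w. frechet_derivative f (at (fst z)) (fst w))) (at z)"
    by (rule has_derivative_compose[OF bounded_linear_imp_has_derivative[OF bounded_linear_fst]])
      (rule has_derivative_frechet[OF assms])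
  then show ?thesis by (simp add: frechet_derivative_eqI)
qed

lemma frechet_derivative_divide:
  fixes f g :: "'a::real_normed_vector \<Rightarrow> real"
  assumes "f differentiable (at z)" "g differentiable (at z)" "g z \<noteq> 0"
  shows "frechet_derivative (\<lambda>z. f z / g z) (at z) w
    = frechet_derivative f (at z) w / g z - f z * frechet_derivative g (at z) w / (g z)\<^sup>2"
proof -
  have "((\<lambda>z. f z / g z) has_derivative
      (\<lambda>w. (frechet_derivative f (at z) w * g z - f z * frechet_derivative g (at z) w) / (g z * g z))) (at z)"
    by (intro has_derivative_divide' has_derivative_frechet assms)
  then show ?thesis
    using assms(3) by (simp add: frechet_derivative_eqI divide_simps power2_eq_square)
qed

locale chart_metric =
  fixes h :: "real^'n::finite \<Rightarrow> real^'n^'n" and V :: "(real^'n) set"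
  assumes open_V: "open V" and smooth_h: "smooth_on V h"
    and symmetric: "x \<in> V \<Longrightarrow> h x $ a $ b = h x $ b $ a"
    and positive: "x \<in> V \<Longrightarrow> u \<noteq> 0 \<Longrightarrow> (\<Sum>a\<in>UNIV. \<Sum>b\<in>UNIV. h x $ a $ b * u $ a * u $ b) > 0"
begin

lemma invertible_h:
  assumes "x \<in> V"
  shows "invertible (h x)"
proof -
  have "u = 0" if "h x *v u = 0" for u
  proof (rule ccontr)
    assume "u \<noteq> 0"
    have "(\<Sum>a\<in>UNIV. \<Sum>b\<in>UNIV. h x $ a $ b * u $ a * u $ b) = (\<Sum>a\<in>UNIV. u $ a * (h x *v u) $ a)"
      by (simp add: matrix_vector_mult_def sum_distrib_left mult_ac)
    then show False using positive[OF assms \<open>u \<noteq> 0\<close>] that by simp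
  qed
  then show ?thesis
    using matrix_left_invertible_ker[of "h x"] invertible_left_inverse[of "h x"] by blast
qed

lemma smooth_h_nth: "smooth_on V (\<lambda>y. h y $ a $ b)"
  by (intro smooth_on_nth smooth_h open_V)

lemma open_cylinder: "open (V \<times> (UNIV :: (real^'n) set))"
  by (simp add: open_V open_Times)

lemma metric_A_eq: "metric_A h = (\<lambda>z. \<Sum>a\<in>UNIV. \<Sum>b\<in>UNIV. h (fst z) $ a $ b * snd z $ a * snd z $ b)"
  by (auto simp: metric_A_def fun_eq_iff)

lemma smooth_h_fst: "smooth_on (V \<times> (UNIV :: (real^'n) set)) (\<lambda>z. h (fst z) $ a $ b)"
  using smooth_on_compose_affine[OF bounded_linear_fst open_cylinder smooth_h_nth, of 0 a b] by auto

lemma smooth_metric_A: "smooth_on (V \<times> UNIV) (metric_A h)"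
  unfolding metric_A_eq
  by (intro smooth_on_sum smooth_on_mult smooth_h_fst smooth_on_snd_nth open_cylinder)

section \<open>The auxiliary metric as a quadratic Lagrangian\<close>

lemma pdv_metric_A:
  assumes "x \<in> V"
  shows "pdv b (metric_A h) (x, v) = 2 * lowered h b (x, v)"
proof -
  let ?q = "\<lambda>z. \<Sum>a\<in>UNIV. \<Sum>b\<in>UNIV. h x $ a $ b * snd z $ a * snd z $ b"
  have "smooth_on (V \<times> UNIV) ?q"
    by (intro smooth_on_sum smooth_on_mult smooth_on_const smooth_on_snd_nth open_cylinder)
  then have "pdv b (metric_A h) (x, v) = pdv b ?q (x, v)"
    using assms smooth_metric_A
    by (intro pdv_cong_fibre[OF open_cylinder]) (auto intro: smooth_on_differentiable simp: metric_A_def)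
  also have "\<dots> = (\<Sum>e\<in>UNIV. (h x $ b $ e + h x $ e $ b) * v $ e)"
    by (subst pdv_quadratic_form) simp
  finally show ?thesis
    by (simp add: lowered_def symmetric[OF assms, of _ b] sum_distrib_left mult.assoc)
qed

lemma Lmetric_metric_A:
  assumes "x \<in> V"
  shows "Lmetric (metric_A h) (x, v) = h x"
proof -
  have "pdv a (pdv b (metric_A h)) (x, v) = 2 * h x $ b $ a" for a b
  proof -
    let ?q = "\<lambda>z. \<Sum>e\<in>UNIV. 2 * h x $ b $ e * snd z $ e"
    have "smooth_on (V \<times> UNIV) ?q"
      by (intro smooth_on_sum smooth_on_mult smooth_on_const smooth_on_snd_nth open_cylinder)
    then have "pdv a (pdv b (metric_A h)) (x, v) = pdv a ?q (x, v)"
      using assms smooth_on_pdv[OF smooth_metric_A]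
      by (intro pdv_cong_fibre[OF open_cylinder])
        (auto intro: smooth_on_differentiable simp: pdv_metric_A lowered_def sum_distrib_left mult.assoc)
    then show ?thesis by (simp only: pdv_linear_form)
  qed
  then show ?thesis by (simp add: Lmetric_def vec_eq_iff symmetric[OF assms])
qed

text \<open>The L-metric of \<open>A\<close> is \<open>h\<close>, so \<open>A\<close> is itself a
  nondegenerate Lagrangian, here on the full cylinder with the zero vectors, where \<open>A\<close>
  is smooth. This makes the rigidity of symmetric connections available for the Christoffel
  symbols.\<close>

sublocale chart_lagrangian "metric_A h" "V \<times> UNIV"
  by unfold_locales (auto simp: open_cylinder smooth_metric_A Lmetric_metric_A invertible_h)

section \<open>Christoffel symbols and metric compatibility\<close>

lemma christoffel_symmetric:
  assumes "x \<in> V"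
  shows "christoffel h a b e x = christoffel h a e b x"
proof -
  have "pd m (\<lambda>y. h y $ b $ e) x = pd m (\<lambda>y. h y $ e $ b) x" for m
    unfolding pd_def
    using frechet_derivative_cong_open[OF open_V smooth_h_nth assms, of b e "\<lambda>y. h y $ e $ b"] symmetric
    by simp
  then show ?thesis unfolding christoffel_def by (simp add: add.commute)
qed

lemma smooth_christoffel: "smooth_on V (christoffel h a b e)"
  unfolding christoffel_def[abs_def]
  by (intro smooth_on_mult smooth_on_const smooth_on_sum smooth_on_diff smooth_on_add smooth_on_pd
      smooth_on_matrix_inv smooth_h_nth open_V invertible_h)

lemma lowered_christoffel:
  assumes "x \<in> V"
  shows "2 * (\<Sum>b\<in>UNIV. h x $ m $ b * christoffel h b a e x)
    = pd a (\<lambda>y. h y $ m $ e) x + pd e (\<lambda>y. h y $ m $ a) x - pd m (\<lambda>y. h y $ a $ e) x"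
proof -
  define w :: "real^'n" where
    "w = (\<chi> m. pd a (\<lambda>y. h y $ m $ e) x + pd e (\<lambda>y. h y $ m $ a) x - pd m (\<lambda>y. h y $ a $ e) x)"
  have c: "(matrix_inv (h x) *v w) $ b = 2 * christoffel h b a e x" for b
    by (simp add: christoffel_def w_def matrix_vector_mult_def)
  have "2 * (\<Sum>b\<in>UNIV. h x $ m $ b * christoffel h b a e x)
      = (\<Sum>b\<in>UNIV. h x $ m $ b * (matrix_inv (h x) *v w) $ b)"
    by (simp add: c sum_distrib_left mult.left_commute)
  also have "\<dots> = (h x *v (matrix_inv (h x) *v w)) $ m"
    by (simp add: matrix_vector_mult_def)
  also have "\<dots> = w $ m"
    by (simp add: matrix_vector_mul_assoc matrix_inv_right[OF invertible_h[OF assms]])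
  finally show ?thesis by (simp add: w_def)
qed

lemma pdx_metric_A:
  assumes "x \<in> V"
  shows "pdx a (metric_A h) (x, v)
    = (\<Sum>m\<in>UNIV. \<Sum>e\<in>UNIV. pd a (\<lambda>y. h y $ m $ e) x * v $ m * v $ e)"
proof -
  have d: "(\<lambda>z. h (fst z) $ m $ e) differentiable (at (x, v))"
    "(\<lambda>y. h y $ m $ e) differentiable (at x)" for m e
    using assms smooth_on_differentiable[OF smooth_h_fst] smooth_on_differentiable[OF smooth_h_nth] by auto
  have d': "frechet_derivative (\<lambda>z. h (fst z) $ m $ e) (at (x, v)) w
      = frechet_derivative (\<lambda>y. h y $ m $ e) (at x) (fst w)" for m e w
    using frechet_derivative_comp_fst[of "\<lambda>y. h y $ m $ e" "(x, v)"] d by simp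
  show ?thesis
    unfolding pdx_def metric_A_eq
    by (subst frechet_derivative_sum)
      (simp_all add: frechet_derivative_sum frechet_derivative_mult differentiable_mult
        differentiable_snd_nth frechet_derivative_snd_nth d d' pd_def)
qed

text \<open>Lowering the upper index turns the Christoffel symbols into three derivatives of
  \<open>h\<close>. Contraction with \<open>v^m v^e\<close>, symmetric in its indices, cancels the
  last two of them.\<close>

lemma horizontally_constant_metric_A:
  assumes x: "x \<in> V"
  shows "horizontally_constant (\<lambda>b a e. christoffel h b a e x) (metric_A h) (x, v)"
  unfolding horizontally_constant_def
proof
  fix a
  have "(\<Sum>b\<in>UNIV. \<Sum>e\<in>UNIV. christoffel h b a e x * v $ e * pdv b (metric_A h) (x, v))
      = (\<Sum>b\<in>UNIV. \<Sum>e\<in>UNIV. \<Sum>m\<in>UNIV. v $ m * v $ e * (2 * (h x $ m $ b * christoffel h b a e x)))"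
    by (simp add: pdv_metric_A[OF x] lowered_def sum_distrib_left symmetric[OF x, of _ b for b] mult_ac)
  also have "\<dots> = (\<Sum>m\<in>UNIV. \<Sum>e\<in>UNIV. \<Sum>b\<in>UNIV. v $ m * v $ e * (2 * (h x $ m $ b * christoffel h b a e x)))"
    by (subst sum.swap, subst sum.swap[of _ UNIV UNIV], rule sum.swap)
  also have "\<dots> = (\<Sum>m\<in>UNIV. \<Sum>e\<in>UNIV. v $ m * v $ e *
      (pd a (\<lambda>y. h y $ m $ e) x + pd e (\<lambda>y. h y $ m $ a) x - pd m (\<lambda>y. h y $ a $ e) x))"
    by (simp add: lowered_christoffel[OF x, symmetric] sum_distrib_left)
  also have "\<dots> = (\<Sum>m\<in>UNIV. \<Sum>e\<in>UNIV. v $ m * v $ e * pd a (\<lambda>y. h y $ m $ e) x)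
      + (\<Sum>m\<in>UNIV. \<Sum>e\<in>UNIV. v $ m * v $ e * pd e (\<lambda>y. h y $ m $ a) x)
      - (\<Sum>m\<in>UNIV. \<Sum>e\<in>UNIV. v $ m * v $ e * pd m (\<lambda>y. h y $ a $ e) x)"
    by (simp add: algebra_simps sum.distrib sum_subtractf)
  also have "(\<Sum>m\<in>UNIV. \<Sum>e\<in>UNIV. v $ m * v $ e * pd m (\<lambda>y. h y $ a $ e) x)
      = (\<Sum>m\<in>UNIV. \<Sum>e\<in>UNIV. v $ m * v $ e * pd e (\<lambda>y. h y $ m $ a) x)"
  proof (subst sum.swap, intro sum.cong refl)
    fix m e
    have "pd e (\<lambda>y. h y $ a $ m) x = pd e (\<lambda>y. h y $ m $ a) x"
      unfolding pd_def
      using frechet_derivative_cong_open[OF open_V smooth_h_nth x, of a m "\<lambda>y. h y $ m $ a"] symmetric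
      by simp
    then show "v $ e * v $ m * pd e (\<lambda>y. h y $ a $ m) x = v $ m * v $ e * pd e (\<lambda>y. h y $ m $ a) x"
      by simp
  qed
  finally show "pdx a (metric_A h) (x, v) = (\<Sum>b\<in>UNIV. \<Sum>e\<in>UNIV.
      christoffel h b a e x * snd (x, v) $ e * pdv b (metric_A h) (x, v))"
    by (simp add: pdx_metric_A[OF x] mult_ac)
qed

text \<open>The metric \<open>A\<close> is horizontally constant for \<open>\<Gamma>\<close>, and
  \<open>\<partial>\<Omega>/\<partial>v\<^sup>b + 2 v\<^sub>b \<Omega> / A = (\<partial>l/\<partial>v\<^sup>b) / A\<close>.\<close>

lemma Omega_condition_iff:
  assumes x: "x \<in> V" and v: "v \<noteq> 0" and l: "l differentiable (at (x, v))"
  shows "pdx a (Omega l h) (x, v)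
      - (\<Sum>b\<in>UNIV. \<Sum>e\<in>UNIV. christoffel h b a e x * v $ e * pdv b (Omega l h) (x, v))
      = (\<Sum>b\<in>UNIV. \<Sum>e\<in>UNIV. T b a e * v $ e *
          (pdv b (Omega l h) (x, v) + 2 * lowered h b (x, v) * Omega l h (x, v) / metric_A h (x, v)))
    \<longleftrightarrow> pdx a l (x, v) = (\<Sum>b\<in>UNIV. \<Sum>e\<in>UNIV. (christoffel h b a e x + T b a e) * v $ e * pdv b l (x, v))"
    (is "?lhs = ?rhs \<longleftrightarrow> _")
proof -
  let ?A = "metric_A h (x, v)" and ?\<Gamma> = "\<lambda>b. \<Sum>e\<in>UNIV. christoffel h b a e x * v $ e"
    and ?T = "\<lambda>b. \<Sum>e\<in>UNIV. T b a e * v $ e"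
  have A: "?A > 0" using positive[OF x v] by (simp add: metric_A_def)
  have dA: "metric_A h differentiable (at (x, v))"
    using x smooth_on_differentiable[OF smooth_metric_A] by auto
  have \<Omega>: "Omega l h = (\<lambda>z. l z / metric_A h z)"
    by (simp add: Omega_def fun_eq_iff)
  have pdx\<Omega>: "pdx a (Omega l h) (x, v) = pdx a l (x, v) / ?A - l (x, v) * pdx a (metric_A h) (x, v) / ?A\<^sup>2"
    unfolding \<Omega> pdx_def using A by (intro frechet_derivative_divide l dA) simp
  have pdv\<Omega>: "pdv b (Omega l h) (x, v) = pdv b l (x, v) / ?A - l (x, v) * (2 * lowered h b (x, v)) / ?A\<^sup>2" for b
    unfolding \<Omega> pdv_metric_A[OF x, symmetric] pdv_def
    using A by (intro frechet_derivative_divide l dA) simp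
  have pdxA: "pdx a (metric_A h) (x, v) = (\<Sum>b\<in>UNIV. ?\<Gamma> b * (2 * lowered h b (x, v)))"
    using horizontally_constant_metric_A[OF x, of v]
    by (simp add: horizontally_constant_def pdv_metric_A[OF x] sum_distrib_right)
  have "?lhs = pdx a (Omega l h) (x, v) - (\<Sum>b\<in>UNIV. ?\<Gamma> b * pdv b (Omega l h) (x, v))"
    by (simp add: sum_distrib_right)
  also have "(\<Sum>b\<in>UNIV. ?\<Gamma> b * pdv b (Omega l h) (x, v))
      = (\<Sum>b\<in>UNIV. ?\<Gamma> b * pdv b l (x, v)) / ?A
        - l (x, v) * (\<Sum>b\<in>UNIV. ?\<Gamma> b * (2 * lowered h b (x, v))) / ?A\<^sup>2"
    unfolding pdv\<Omega> sum_divide_distrib sum_distrib_left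
    by (simp add: sum_subtractf[symmetric] right_diff_distrib mult_ac)
  \<comment> \<open>The terms with \<open>l / A^2\<close> that the quotient rule produces in both
    parts cancel by \<open>pdxA\<close>, the horizontal constancy of \<open>A\<close>.\<close>
  finally have lhs: "?lhs = (pdx a l (x, v) - (\<Sum>b\<in>UNIV. ?\<Gamma> b * pdv b l (x, v))) / ?A"
    by (simp add: pdx\<Omega> pdxA diff_divide_distrib)
  have "pdv b (Omega l h) (x, v) + 2 * lowered h b (x, v) * Omega l h (x, v) / ?A = pdv b l (x, v) / ?A" for b
    by (simp add: pdv\<Omega> Omega_def power2_eq_square mult_ac)
  then have rhs: "?rhs = (\<Sum>b\<in>UNIV. ?T b * pdv b l (x, v)) / ?A"
    by (simp add: sum_distrib_right sum_divide_distrib)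
  have "(\<Sum>b\<in>UNIV. \<Sum>e\<in>UNIV. (christoffel h b a e x + T b a e) * v $ e * pdv b l (x, v))
      = (\<Sum>b\<in>UNIV. ?\<Gamma> b * pdv b l (x, v)) + (\<Sum>b\<in>UNIV. ?T b * pdv b l (x, v))"
    by (simp add: sum_distrib_right sum.distrib distrib_right)
  then show ?thesis
    unfolding lhs rhs using A by auto
qed

end

section \<open>Change of coordinates\<close>

text \<open>\<open>J\<close> is the Jacobian of the change of coordinates, \<open>K\<close> the inverse of \<open>J\<close>, and \<open>H i a e\<close> the second
  derivative of the \<open>i\<close>-th new coordinate.\<close>

definition transform_connection ::
  "real^'n^'n \<Rightarrow> real^'n^'n \<Rightarrow> ('n \<Rightarrow> 'n \<Rightarrow> 'n \<Rightarrow> real) \<Rightarrow> ('n::finite \<Rightarrow> 'n \<Rightarrow> 'n \<Rightarrow> real) \<Rightarrow> 'n \<Rightarrow> 'n \<Rightarrow> 'n \<Rightarrow> real" where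
  "transform_connection J K H D i r s =
     (\<Sum>a\<in>UNIV. \<Sum>e\<in>UNIV. K $ a $ r * K $ e $ s * ((\<Sum>b\<in>UNIV. J $ i $ b * D b a e) - H i a e))"

lemma transform_connection_symmetric:
  assumes "\<And>i a e. H i a e = H i e a" "\<And>b a e. D b a e = D b e a"
  shows "transform_connection J K H D i r s = transform_connection J K H D i s r"
  unfolding transform_connection_def
  by (subst sum.swap) (simp add: assms(1)[of _ _ a for a] assms(2)[of _ _ a for a] mult_ac)

text \<open>The second-derivative term \<open>H\<close> is common to both connections and drops out,
  which leaves the homogeneous law of a tensor.\<close>

lemma transform_connection_diff:
  "transform_connection J K H D i r s - transform_connection J K H D' i r s
    = (\<Sum>b\<in>UNIV. \<Sum>a\<in>UNIV. \<Sum>e\<in>UNIV. J $ i $ b * K $ a $ r * K $ e $ s * (D b a e - D' b a e))"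
proof -
  have "transform_connection J K H D i r s - transform_connection J K H D' i r s
    = (\<Sum>a\<in>UNIV. \<Sum>e\<in>UNIV. \<Sum>b\<in>UNIV. J $ i $ b * K $ a $ r * K $ e $ s * (D b a e - D' b a e))"
    unfolding transform_connection_def sum_subtractf[symmetric] right_diff_distrib[symmetric]
    by (simp add: sum_subtractf[symmetric] right_diff_distrib[symmetric])
      (simp add: sum_distrib_left mult_ac)
  also have "\<dots> = (\<Sum>a\<in>UNIV. \<Sum>b\<in>UNIV. \<Sum>e\<in>UNIV. J $ i $ b * K $ a $ r * K $ e $ s * (D b a e - D' b a e))"
    by (rule sum.cong[OF refl], rule sum.swap)
  also have "\<dots> = (\<Sum>b\<in>UNIV. \<Sum>a\<in>UNIV. \<Sum>e\<in>UNIV. J $ i $ b * K $ a $ r * K $ e $ s * (D b a e - D' b a e))"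
    by (rule sum.swap)
  finally show ?thesis .
qed

section \<open>Jacobians and the tangent map\<close>

definition jacobian_at :: "(real^'n::finite \<Rightarrow> real^'n) \<Rightarrow> real^'n \<Rightarrow> real^'n^'n" where
  "jacobian_at \<phi> y = matrix (frechet_derivative \<phi> (at y))"

lemma jacobian_at_nth:
  assumes "\<phi> differentiable (at y)"
  shows "jacobian_at \<phi> y $ i $ j = pd j (\<lambda>y. \<phi> y $ i) y"
proof -
  have "((\<lambda>y. \<phi> y $ i) has_derivative (\<lambda>w. frechet_derivative \<phi> (at y) w $ i)) (at y)"
    using bounded_linear.has_derivative[OF bounded_linear_vec_nth has_derivative_frechet[OF assms]] .
  then show ?thesis
    by (simp add: jacobian_at_def matrix_def pd_def frechet_derivative_eqI)
qed

lemma smooth_on_jacobian_at: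
  assumes "open W" "smooth_on W \<phi>"
  shows "smooth_on W (\<lambda>y. jacobian_at \<phi> y $ i $ j)"
proof -
  have "smooth_on W (pd j (\<lambda>y. \<phi> y $ i))"
    by (intro smooth_on_pd smooth_on_nth assms)
  then show ?thesis
    using smooth_on_cong[OF assms(1), of "\<lambda>y. jacobian_at \<phi> y $ i $ j" "pd j (\<lambda>y. \<phi> y $ i)"]
      jacobian_at_nth[OF smooth_on_differentiable[OF assms(2)]] by blast
qed

text \<open>Both sides are second derivatives of one coordinate function. This keeps the
  inhomogeneous term, and with it the transported connection, symmetric.\<close>

lemma pd_jacobian_at_symmetric:
  assumes "open W" "smooth_on W \<phi>" "x \<in> W"
  shows "pd a (\<lambda>y. jacobian_at \<phi> y $ i $ e) x = pd e (\<lambda>y. jacobian_at \<phi> y $ i $ a) x"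
proof -
  have \<phi>: "smooth_on W (\<lambda>y. \<phi> y $ i)" by (intro smooth_on_nth assms)
  have "pd a (\<lambda>y. jacobian_at \<phi> y $ i $ e) x = pd a (pd e (\<lambda>y. \<phi> y $ i)) x" for a e
  proof -
    have "frechet_derivative (\<lambda>y. jacobian_at \<phi> y $ i $ e) (at x)
        = frechet_derivative (pd e (\<lambda>y. \<phi> y $ i)) (at x)"
      by (rule frechet_derivative_cong_open[OF assms(1) smooth_on_jacobian_at[OF assms(1,2)] assms(3)])
        (rule jacobian_at_nth[OF smooth_on_differentiable[OF assms(2)]])
    then show ?thesis by (simp add: pd_def[of a])
  qed
  then show ?thesis
    unfolding pd_def[abs_def] using frechet_derivative_commute[OF assms(1) \<phi> assms(3)] by simp
qed

text \<open>Chain rule for the tangent map of \<open>\<phi>\<close>. Moving the base point also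
  varies the Jacobian that acts on the fixed vector \<open>v\<close>; this term is the origin of the
  inhomogeneous part in the law of connections.\<close>

lemma frechet_derivative_tangent_map:
  fixes \<phi> :: "real^'n::finite \<Rightarrow> real^'n" and f k :: "(real^'n) \<times> (real^'n) \<Rightarrow> real"
  assumes W: "open W" "smooth_on W \<phi>" "x \<in> W"
    and N: "open N" "(x, v) \<in> N" "\<And>y u. (y, u) \<in> N \<Longrightarrow> f (y, u) = k (\<phi> y, jacobian_at \<phi> y *v u)"
    and k: "k differentiable (at (\<phi> x, jacobian_at \<phi> x *v v))"
  shows "frechet_derivative f (at (x, v)) (p, w) =
    frechet_derivative k (at (\<phi> x, jacobian_at \<phi> x *v v))
      (jacobian_at \<phi> x *v p,
       \<chi> i. \<Sum>j\<in>UNIV. frechet_derivative (\<lambda>y. jacobian_at \<phi> y $ i $ j) (at x) p * v $ j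
          + jacobian_at \<phi> x $ i $ j * w $ j)"
proof -
  have \<phi>': "frechet_derivative \<phi> (at x) = (\<lambda>p. jacobian_at \<phi> x *v p)"
    unfolding jacobian_at_def
    using linear_frechet_derivative[OF smooth_on_differentiable[OF W(2,3)]] by (simp add: matrix_works fun_eq_iff)
  have fst': "((\<lambda>z. \<phi> (fst z)) has_derivative (\<lambda>q. jacobian_at \<phi> x *v fst q)) (at (x, v))"
    using has_derivative_compose[OF bounded_linear_imp_has_derivative[OF bounded_linear_fst],
        of \<phi> "frechet_derivative \<phi> (at x)" "(x, v)"]
      has_derivative_frechet[OF smooth_on_differentiable[OF W(2,3)]] by (simp add: \<phi>')
  have J: "((\<lambda>z. jacobian_at \<phi> (fst z) $ i $ j) has_derivative
      (\<lambda>q. frechet_derivative (\<lambda>y. jacobian_at \<phi> y $ i $ j) (at x) (fst q))) (at (x, v))" for i j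
    using has_derivative_compose[OF bounded_linear_imp_has_derivative[OF bounded_linear_fst],
        of "\<lambda>y. jacobian_at \<phi> y $ i $ j" "frechet_derivative (\<lambda>y. jacobian_at \<phi> y $ i $ j) (at x)" "(x, v)"]
      has_derivative_frechet[OF smooth_on_differentiable[OF smooth_on_jacobian_at[OF W(1,2)] W(3)]] by simp
  have s: "((\<lambda>z. snd z $ j) has_derivative (\<lambda>q. snd q $ j)) (at z)" for j :: 'n and z :: "(real^'n) \<times> (real^'n)"
    by (intro bounded_linear_imp_has_derivative bounded_linear_compose[OF bounded_linear_vec_nth bounded_linear_snd])
  have comp: "((\<lambda>z. \<Sum>j\<in>UNIV. jacobian_at \<phi> (fst z) $ i $ j * snd z $ j) has_derivative
      (\<lambda>q. \<Sum>j\<in>UNIV. jacobian_at \<phi> x $ i $ j * snd q $ j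
        + frechet_derivative (\<lambda>y. jacobian_at \<phi> y $ i $ j) (at x) (fst q) * v $ j)) (at (x, v))" for i
    using has_derivative_sum[OF has_derivative_mult[OF J s]] by simp
  have snd': "((\<lambda>z. jacobian_at \<phi> (fst z) *v snd z) has_derivative
      (\<lambda>q. \<chi> i. \<Sum>j\<in>UNIV. frechet_derivative (\<lambda>y. jacobian_at \<phi> y $ i $ j) (at x) (fst q) * v $ j
        + jacobian_at \<phi> x $ i $ j * snd q $ j)) (at (x, v))"
    unfolding has_derivative_componentwise_within[of "\<lambda>z. jacobian_at \<phi> (fst z) *v snd z"]
    using comp by (auto simp: Basis_vec_def inner_axis matrix_vector_mult_def add.commute)
  have "((\<lambda>z. k (\<phi> (fst z), jacobian_at \<phi> (fst z) *v snd z)) has_derivative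
      (\<lambda>q. frechet_derivative k (at (\<phi> x, jacobian_at \<phi> x *v v)) (jacobian_at \<phi> x *v fst q,
         \<chi> i. \<Sum>j\<in>UNIV. frechet_derivative (\<lambda>y. jacobian_at \<phi> y $ i $ j) (at x) (fst q) * v $ j
        + jacobian_at \<phi> x $ i $ j * snd q $ j))) (at (x, v))"
    using has_derivative_compose[OF has_derivative_Pair[OF fst' snd'], of k] has_derivative_frechet[OF k] by simp
  then have "(f has_derivative
      (\<lambda>q. frechet_derivative k (at (\<phi> x, jacobian_at \<phi> x *v v)) (jacobian_at \<phi> x *v fst q,
         \<chi> i. \<Sum>j\<in>UNIV. frechet_derivative (\<lambda>y. jacobian_at \<phi> y $ i $ j) (at x) (fst q) * v $ j
        + jacobian_at \<phi> x $ i $ j * snd q $ j))) (at (x, v))"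
    by (rule has_derivative_transform_within_open[OF _ N(1,2)]) (use N(3) in auto)
  then show ?thesis by (simp add: frechet_derivative_eqI)
qed

lemma frechet_derivative_pdx_pdv:
  fixes k :: "(real^'n::finite) \<times> (real^'n) \<Rightarrow> real"
  assumes "k differentiable (at z)"
  shows "frechet_derivative k (at z) (p, w) = (\<Sum>i\<in>UNIV. p $ i * pdx i k z) + (\<Sum>i\<in>UNIV. w $ i * pdv i k z)"
proof -
  have lin: "linear (frechet_derivative k (at z))"
    by (rule linear_frechet_derivative[OF assms])
  have "(p, w) = (\<Sum>i\<in>UNIV. p $ i *\<^sub>R (axis i 1, 0)) + (\<Sum>i\<in>UNIV. w $ i *\<^sub>R (0, axis i 1))" (is "_ = ?r")
    using basis_expansion[of p] basis_expansion[of w]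
    by (simp add: prod_eq_iff fst_sum snd_sum scalar_mult_eq_scaleR)
  then have "frechet_derivative k (at z) (p, w) = frechet_derivative k (at z) ?r" by (rule arg_cong)
  then show ?thesis
    by (simp add: pdv_def pdx_def linear_add[OF lin] linear_sum[OF lin] linear_cmul[OF lin] del: scaleR_Pair)
qed

text \<open>The fibre derivatives of \<open>f\<close> combine those of \<open>k\<close> with
  coefficients \<open>J\<close>, while the base derivatives carry an additional \<open>H\<close>
  term. Substituting both, moving the \<open>H\<close> term across and contracting with
  \<open>K\<close> isolates \<open>pdx r k\<close>; writing \<open>v\<close> as
  \<open>K *v v'\<close> produces the second factor \<open>K\<close>.\<close>

lemma horizontally_constant_transform:
  fixes \<phi> :: "real^'n::finite \<Rightarrow> real^'n" and f k :: "(real^'n) \<times> (real^'n) \<Rightarrow> real"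
  assumes W: "open W" "smooth_on W \<phi>" "x \<in> W"
    and N: "open N" "(x, v) \<in> N" "\<And>y u. (y, u) \<in> N \<Longrightarrow> f (y, u) = k (\<phi> y, jacobian_at \<phi> y *v u)"
    and k: "k differentiable (at (\<phi> x, jacobian_at \<phi> x *v v))"
    and K: "jacobian_at \<phi> x ** K = mat 1"
    and hc: "horizontally_constant D f (x, v)"
  shows "horizontally_constant
    (transform_connection (jacobian_at \<phi> x) K (\<lambda>i a e. pd a (\<lambda>y. jacobian_at \<phi> y $ i $ e) x) D) k
    (\<phi> x, jacobian_at \<phi> x *v v)"
proof -
  define J where "J = jacobian_at \<phi> x"
  define v' where "v' = J *v v"
  let ?z = "(\<phi> x, v')"
  define H where "H i a e = pd a (\<lambda>y. jacobian_at \<phi> y $ i $ e) x" for i a e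
  have KJ: "K ** J = mat 1"
    using K matrix_left_right_inverse[of J K] by (simp add: J_def)
  have v: "v $ e = (\<Sum>s\<in>UNIV. K $ e $ s * v' $ s)" for e
  proof -
    have "K *v v' = v" by (simp add: v'_def matrix_vector_mul_assoc KJ)
    then show ?thesis by (auto simp: matrix_vector_mult_def)
  qed
  have Df: "frechet_derivative f (at (x, v)) (p, w) = (\<Sum>i\<in>UNIV. (J *v p) $ i * pdx i k ?z)
      + (\<Sum>i\<in>UNIV. (\<Sum>j\<in>UNIV. frechet_derivative (\<lambda>y. jacobian_at \<phi> y $ i $ j) (at x) p * v $ j
          + J $ i $ j * w $ j) * pdv i k ?z)" for p w
    using frechet_derivative_tangent_map[where f = f and k = k and p = p and w = w, OF W N k]
    by (simp add: frechet_derivative_pdx_pdv[OF k] J_def v'_def)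
  have pdx: "pdx a f (x, v) = (\<Sum>i\<in>UNIV. J $ i $ a * pdx i k ?z) + (\<Sum>i\<in>UNIV. \<Sum>e\<in>UNIV. H i a e * v $ e * pdv i k ?z)" for a
    unfolding pdx_def[of _ f] Df
    by (simp add: matrix_vector_mult_def sum_axis_right H_def pd_def sum_distrib_right)
  have "linear (frechet_derivative (\<lambda>y. jacobian_at \<phi> y $ i $ j) (at x))" for i j
    by (rule linear_frechet_derivative[OF smooth_on_differentiable[OF smooth_on_jacobian_at[OF W(1,2)] W(3)]])
  then have pdv: "pdv b f (x, v) = (\<Sum>i\<in>UNIV. J $ i $ b * pdv i k ?z)" for b
    unfolding pdv_def[of _ f] Df by (simp add: sum_axis_right linear_0)
  have main: "(\<Sum>i\<in>UNIV. J $ i $ a * pdx i k ?z)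
      = (\<Sum>i\<in>UNIV. \<Sum>e\<in>UNIV. ((\<Sum>b\<in>UNIV. J $ i $ b * D b a e) - H i a e) * v $ e * pdv i k ?z)" for a
  proof -
    have "pdx a f (x, v) = (\<Sum>b\<in>UNIV. \<Sum>e\<in>UNIV. \<Sum>i\<in>UNIV. J $ i $ b * D b a e * v $ e * pdv i k ?z)"
      using hc by (simp add: horizontally_constant_def pdv sum_distrib_left mult_ac)
    also have "\<dots> = (\<Sum>i\<in>UNIV. \<Sum>e\<in>UNIV. \<Sum>b\<in>UNIV. J $ i $ b * D b a e * v $ e * pdv i k ?z)"
      by (subst sum.swap, subst sum.swap[of _ UNIV UNIV], rule sum.swap)
    finally show ?thesis
      unfolding pdx by (simp add: left_diff_distrib sum_subtractf sum_distrib_right)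
  qed
  have "pdx r k ?z = (\<Sum>i\<in>UNIV. \<Sum>s\<in>UNIV. transform_connection J K H D i r s * v' $ s * pdv i k ?z)" for r
  proof -
    define E where "E i a e = (\<Sum>b\<in>UNIV. J $ i $ b * D b a e) - H i a e" for i a e
    have JK: "(\<Sum>a\<in>UNIV. J $ i $ a * K $ a $ r) = (if i = r then 1 else 0)" for i
      using K by (auto simp: J_def[symmetric] matrix_matrix_mult_def mat_def vec_eq_iff)
    \<comment> \<open>The identity matrix \<open>J ** K\<close> is inserted so that
      \<open>main\<close> becomes applicable once the sums are exchanged.\<close>
    have "pdx r k ?z = (\<Sum>i\<in>UNIV. (\<Sum>a\<in>UNIV. J $ i $ a * K $ a $ r) * pdx i k ?z)"
      by (simp add: JK if_distrib[of "\<lambda>t. t * _"] cong: if_cong)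
    also have "\<dots> = (\<Sum>a\<in>UNIV. K $ a $ r * (\<Sum>i\<in>UNIV. J $ i $ a * pdx i k ?z))"
      unfolding sum_distrib_left sum_distrib_right by (subst sum.swap) (simp add: mult_ac)
    also have "\<dots> = (\<Sum>a\<in>UNIV. \<Sum>i\<in>UNIV. \<Sum>e\<in>UNIV. \<Sum>s\<in>UNIV. K $ a $ r * E i a e * K $ e $ s * v' $ s * pdv i k ?z)"
      unfolding main E_def[symmetric] v sum_distrib_left sum_distrib_right by (simp add: mult_ac)
    also have "\<dots> = (\<Sum>i\<in>UNIV. \<Sum>a\<in>UNIV. \<Sum>e\<in>UNIV. \<Sum>s\<in>UNIV. K $ a $ r * E i a e * K $ e $ s * v' $ s * pdv i k ?z)"
      by (rule sum.swap)
    also have "\<dots> = (\<Sum>i\<in>UNIV. \<Sum>a\<in>UNIV. \<Sum>s\<in>UNIV. \<Sum>e\<in>UNIV. K $ a $ r * E i a e * K $ e $ s * v' $ s * pdv i k ?z)"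
      by (rule sum.cong[OF refl], rule sum.cong[OF refl], rule sum.swap)
    also have "\<dots> = (\<Sum>i\<in>UNIV. \<Sum>s\<in>UNIV. \<Sum>a\<in>UNIV. \<Sum>e\<in>UNIV. K $ a $ r * E i a e * K $ e $ s * v' $ s * pdv i k ?z)"
      by (rule sum.cong[OF refl], rule sum.swap)
    also have "\<dots> = (\<Sum>i\<in>UNIV. \<Sum>s\<in>UNIV. transform_connection J K H D i r s * v' $ s * pdv i k ?z)"
      unfolding transform_connection_def E_def[symmetric] sum_distrib_right by (simp add: mult_ac)
    finally show ?thesis .
  qed
  then show ?thesis
    unfolding horizontally_constant_def J_def v'_def H_def[abs_def] by simp
qed

section \<open>Finsler Lagrangians on manifolds\<close>

lemma is_chart_inj_on: "is_chart X c \<Longrightarrow> inj_on (cmap c) (cdom c)"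
  unfolding is_chart_def
  using homeomorphic_imp_injective_map[of "subtopology X (cdom c)" "top_of_set (cmap c ` cdom c)" "cmap c"]
  by (simp add: Int_absorb1 openin_subset)

lemma is_chart_open_image:
  assumes c: "is_chart X c" and S: "openin X S" "S \<subseteq> cdom c"
  shows "open (cmap c ` S)"
proof -
  have "open_map (subtopology X (cdom c)) (top_of_set (cmap c ` cdom c)) (cmap c)"
    using c homeomorphic_imp_open_map unfolding is_chart_def by blast
  moreover have "openin (subtopology X (cdom c)) S"
    using S by (metis inf.absorb1 openin_subtopology_Int)
  ultimately have "openin (top_of_set (cmap c ` cdom c)) (cmap c ` S)"
    unfolding open_map_def by blast
  then show ?thesis
    using c openin_open_trans unfolding is_chart_def by blast
qed

locale finsler_manifold =
  fixes X :: "'m topology"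
    and \<U> :: "('m, 'n::finite) chart set"
    and L :: "('m, 'n) tvec \<Rightarrow> real"
    and \<A> :: "('m, 'n) tvec set"
    and g :: "('m, 'n) chart \<Rightarrow> real^'n \<Rightarrow> real^'n^'n"
  assumes manifold: "smooth_manifold X \<U>"
    and lagrangian: "finsler_lagrangian \<U> \<A> L"
    and nonzero: "\<A> \<subseteq> tangent_bundle \<U> - zero_section \<U>"
    and metric: "riemannian_metric \<U> g"
begin

section \<open>Charts and transition maps\<close>

lemma chart: "c \<in> \<U> \<Longrightarrow> is_chart X c"
  using manifold by (simp add: smooth_manifold_def smooth_atlas_def)

lemma cmap_inj: "c \<in> \<U> \<Longrightarrow> p \<in> cdom c \<Longrightarrow> q \<in> cdom c \<Longrightarrow> cmap c p = cmap c q \<Longrightarrow> p = q"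
  using is_chart_inj_on[OF chart] by (meson inj_onD)

lemma open_overlap:
  assumes "c \<in> \<U>" "d \<in> \<U>"
  shows "open (cmap c ` (cdom c \<inter> cdom d))"
  using assms chart[unfolded is_chart_def] by (intro is_chart_open_image[OF chart] openin_Int) auto

lemma smooth_transition: "c \<in> \<U> \<Longrightarrow> d \<in> \<U> \<Longrightarrow> smooth_on (cmap c ` (cdom c \<inter> cdom d)) (transition c d)"
  using manifold by (simp add: smooth_manifold_def smooth_atlas_def)

lemma transition_cmap: "c \<in> \<U> \<Longrightarrow> p \<in> cdom c \<Longrightarrow> transition c d (cmap c p) = cmap d p"
  by (simp add: transition_def is_chart_inj_on[OF chart])

lemma jac_eq: "jac c d p = jacobian_at (transition c d) (cmap c p)"
  by (simp add: jac_def jacobian_at_def)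

text \<open>Chain rule for \<open>transition c d \<circ> transition d c\<close>, which is the
  identity on the image of the overlap; that image is open, so the derivative is the identity as
  well.\<close>

lemma jac_inverse:
  assumes "c \<in> \<U>" "d \<in> \<U>" "p \<in> cdom c" "p \<in> cdom d"
  shows "jac c d p ** jac d c p = mat 1"
proof -
  let ?f = "transition c d" and ?g = "transition d c" and ?W = "cmap d ` (cdom d \<inter> cdom c)"
  have f: "?f differentiable (at (cmap c p))" and g: "?g differentiable (at (cmap d p))"
    using smooth_on_differentiable[OF smooth_transition] assms by blast+
  have gp: "?g (cmap d p) = cmap c p" using assms by (simp add: transition_cmap)
  have "(?f \<circ> ?g) differentiable (at (cmap d p))"
    using differentiable_chain_at[OF g] f gp by simp
  then have "frechet_derivative (?f \<circ> ?g) (at (cmap d p)) = frechet_derivative id (at (cmap d p))"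
    using assms
    by (rule_tac frechet_derivative_transform_within_open[OF _ open_overlap[of d c]])
      (auto simp: transition_cmap)
  then have "frechet_derivative ?f (at (cmap c p)) \<circ> frechet_derivative ?g (at (cmap d p)) = id"
    using frechet_derivative_compose[OF g f[folded gp]] by (simp add: gp)
  then show ?thesis
    unfolding jac_def
    using matrix_compose[OF linear_frechet_derivative[OF g] linear_frechet_derivative[OF f]]
    by (simp add: matrix_id_mat_1)
qed

section \<open>Tangent vectors and the Lagrangian in charts\<close>

lemma tangent_component:
  assumes "(p, v) \<in> tangent_bundle \<U>" "c \<in> \<U>" "p \<in> cdom c"
  shows "v d = (if d \<in> \<U> \<and> p \<in> cdom d then jac c d p *v v c else 0)"
proof (cases "d \<in> \<U> \<and> p \<in> cdom d")
  case True
  then have "v d = jac c d p *v v c" using assms unfolding tangent_bundle_def by blast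
  then show ?thesis unfolding if_P[OF True] .
next
  case False
  then have "v d = 0" using assms unfolding tangent_bundle_def by blast
  then show ?thesis unfolding if_not_P[OF False] .
qed

text \<open>The base point and the component in one chart determine all others: those in charts
  around the point by the Jacobian, the rest by the default value 0.\<close>

lemma inj_on_tcoords: "c \<in> \<U> \<Longrightarrow> inj_on (tcoords c) (tangent_over \<U> c)"
proof (rule inj_onI)
  fix w w'
  assume c: "c \<in> \<U>" and w: "w \<in> tangent_over \<U> c" "w' \<in> tangent_over \<U> c" "tcoords c w = tcoords c w'"
  obtain p v p' v' where pv: "w = (p, v)" "w' = (p', v')" by fastforce
  then have p: "p' = p" "p \<in> cdom c" and vc: "v' c = v c"
    using w c cmap_inj by (auto simp: tangent_over_def tcoords_def)
  have tb: "(p, v) \<in> tangent_bundle \<U>" "(p, v') \<in> tangent_bundle \<U>"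
    using w(1,2) p(1) by (auto simp: pv tangent_over_def)
  have "v d = v' d" for d
    by (rule trans[OF tangent_component[OF tb(1) c p(2)]], subst vc[symmetric],
        rule tangent_component[OF tb(2) c p(2), symmetric])
  then show "w = w'" using pv p by (simp add: fun_eq_iff)
qed

lemma local_rep_tcoords:
  "c \<in> \<U> \<Longrightarrow> w \<in> tangent_over \<U> c \<Longrightarrow> local_rep \<U> c L (tcoords c w) = L w"
  by (simp add: local_rep_def inj_on_tcoords)

lemma chart_lagrangian: "c \<in> \<U> \<Longrightarrow> chart_lagrangian (local_rep \<U> c L) (local_image \<U> c \<A>)"
  using lagrangian unfolding finsler_lagrangian_def conic_subbundle_def chart_lagrangian_def by blast

lemma chart_metric: "c \<in> \<U> \<Longrightarrow> chart_metric (g c) (cmap c ` cdom c)"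
  using metric chart[unfolded is_chart_def]
  by (intro chart_metric.intro) (auto simp: riemannian_metric_def)

lemma local_imageE:
  assumes "(x, v) \<in> local_image \<U> c \<A>"
  obtains p \<omega> where "(p, \<omega>) \<in> \<A>" "(p, \<omega>) \<in> tangent_over \<U> c" "p \<in> cdom c" "x = cmap c p" "v = \<omega> c"
  using assms unfolding local_image_def tangent_over_def tcoords_def by auto

lemma local_image_base: "(x, v) \<in> local_image \<U> c \<A> \<Longrightarrow> x \<in> cmap c ` cdom c"
  by (auto elim: local_imageE)

text \<open>A vector that vanishes in one chart vanishes in all, hence lies in the zero section,
  which \<open>\<A>\<close> avoids. So \<open>metric_A\<close> is positive wherever
  \<open>Omega\<close> divides by it.\<close>

lemma local_image_nonzero:
  assumes c: "c \<in> \<U>" and "(x, v) \<in> local_image \<U> c \<A>"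
  shows "v \<noteq> 0"
proof
  assume "v = 0"
  obtain p \<omega> where p: "(p, \<omega>) \<in> \<A>" "p \<in> cdom c" "v = \<omega> c"
    using assms(2) by (rule local_imageE)
  have tb: "(p, \<omega>) \<in> tangent_bundle \<U>" using p(1) nonzero by blast
  have "\<omega> c = 0" using p(3) \<open>v = 0\<close> by simp
  then have "\<omega> d = 0" for d
    using tangent_component[OF tb c p(2), of d] by simp
  then have "(p, \<omega>) \<in> zero_section \<U>" using tb by (auto simp: zero_section_def)
  then show False using p(1) nonzero by blast
qed

text \<open>Rigidity and the recovery of coefficients need a vector of \<open>\<A>\<close> over each
  base point.\<close>

lemma fibre_nonempty:
  assumes "c \<in> \<U>" "x \<in> cmap c ` cdom c"
  obtains v where "(x, v) \<in> local_image \<U> c \<A>"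
proof -
  obtain p where p: "p \<in> cdom c" "x = cmap c p" using assms(2) by blast
  obtain \<omega> where \<omega>: "(p, \<omega>) \<in> \<A>"
    using lagrangian p assms(1) unfolding finsler_lagrangian_def conic_subbundle_def by blast
  then have "(p, \<omega>) \<in> tangent_over \<U> c"
    using nonzero p by (auto simp: tangent_over_def)
  then have "tcoords c (p, \<omega>) \<in> local_image \<U> c \<A>"
    using \<omega> unfolding local_image_def by blast
  then show ?thesis using that p by (simp add: tcoords_def)
qed

lemma local_rep_homogeneous:
  assumes c: "c \<in> \<U>" and "(x, v) \<in> local_image \<U> c \<A>" and "r > 0"
  shows "local_rep \<U> c L (x, r *\<^sub>R v) = r\<^sup>2 * local_rep \<U> c L (x, v)"
proof -
  obtain p \<omega> where p: "(p, \<omega>) \<in> \<A>" "(p, \<omega>) \<in> tangent_over \<U> c" "p \<in> cdom c" "x = cmap c p" "v = \<omega> c"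
    using assms(2) by (rule local_imageE)
  have "tscale r (p, \<omega>) \<in> \<A>"
    using lagrangian p(1) \<open>r > 0\<close> unfolding finsler_lagrangian_def conic_subbundle_def by blast
  then have "tscale r (p, \<omega>) \<in> tangent_over \<U> c"
    using nonzero p(3) by (auto simp: tangent_over_def tscale_def)
  then have "local_rep \<U> c L (tcoords c (tscale r (p, \<omega>))) = L (tscale r (p, \<omega>))"
    by (rule local_rep_tcoords[OF c])
  also have "\<dots> = r\<^sup>2 * L (p, \<omega>)"
    using lagrangian p(1) nonzero \<open>r > 0\<close> unfolding finsler_lagrangian_def by blast
  also have "L (p, \<omega>) = local_rep \<U> c L (tcoords c (p, \<omega>))"
    using local_rep_tcoords[OF c p(2)] by simp
  finally show ?thesis by (simp add: tcoords_def tscale_def p)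
qed

text \<open>Both local expressions evaluate the same \<open>L\<close> at the same tangent vector,
  whose components are related by the Jacobian.\<close>

lemma change_of_chart:
  assumes cd: "c \<in> \<U>" "d \<in> \<U>" and "(x, v) \<in> local_image \<U> c \<A>" and x: "x \<in> cmap c ` (cdom c \<inter> cdom d)"
  shows "(transition c d x, jacobian_at (transition c d) x *v v) \<in> local_image \<U> d \<A>" (is ?thesis1)
    and "local_rep \<U> c L (x, v) = local_rep \<U> d L (transition c d x, jacobian_at (transition c d) x *v v)"
      (is ?thesis2)
proof -
  obtain p \<omega> where p: "(p, \<omega>) \<in> \<A>" "(p, \<omega>) \<in> tangent_over \<U> c" "p \<in> cdom c" "x = cmap c p" "v = \<omega> c"
    using assms(3) by (rule local_imageE)
  then have pd: "p \<in> cdom d" using x cmap_inj[OF cd(1)] by blast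
  then have pd': "(p, \<omega>) \<in> tangent_over \<U> d"
    using p(2) by (simp add: tangent_over_def)
  have "\<omega> d = jac c d p *v \<omega> c"
    using p(2,3) pd cd unfolding tangent_over_def tangent_bundle_def by blast
  then have eq: "tcoords d (p, \<omega>) = (transition c d x, jacobian_at (transition c d) x *v v)"
    using p cd by (simp add: tcoords_def transition_cmap jac_eq)
  show ?thesis1
    using p(1) pd' unfolding eq[symmetric] local_image_def by blast
  have "(x, v) = tcoords c (p, \<omega>)" using p by (simp add: tcoords_def)
  then show ?thesis2
    unfolding eq[symmetric] using local_rep_tcoords[OF cd(1) p(2)] local_rep_tcoords[OF cd(2) pd'] by simp
qed

section \<open>Metric and connections under a change of chart\<close>

lemma metric_A_change_of_chart:
  assumes cd: "c \<in> \<U>" "d \<in> \<U>" and x: "x \<in> cmap c ` (cdom c \<inter> cdom d)"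
  shows "metric_A (g c) (x, v) = metric_A (g d) (transition c d x, jacobian_at (transition c d) x *v v)"
proof -
  obtain p where p: "p \<in> cdom c" "p \<in> cdom d" "x = cmap c p" using x by blast
  define J where "J = jac c d p"
  have J: "jacobian_at (transition c d) x = J" by (simp add: J_def jac_eq p)
  let ?h = "g d (cmap d p)"
  \<comment> \<open>The tensor law is read with the roles of \<open>c\<close> and \<open>d\<close>
    exchanged, so that only the Jacobian from \<open>c\<close> to \<open>d\<close> occurs.\<close>
  have gc: "g c x $ a $ b = (\<Sum>i\<in>UNIV. \<Sum>j\<in>UNIV. J $ i $ a * J $ j $ b * ?h $ i $ j)" for a b
    using metric cd p unfolding riemannian_metric_def J_def by blast
  have "metric_A (g c) (x, v)
      = (\<Sum>a\<in>UNIV. \<Sum>b\<in>UNIV. \<Sum>i\<in>UNIV. \<Sum>j\<in>UNIV. ?h $ i $ j * (J $ i $ a * v $ a) * (J $ j $ b * v $ b))"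
    by (simp add: metric_A_def gc sum_distrib_left sum_distrib_right mult_ac)
  also have "\<dots> = (\<Sum>a\<in>UNIV. \<Sum>i\<in>UNIV. \<Sum>b\<in>UNIV. \<Sum>j\<in>UNIV. ?h $ i $ j * (J $ i $ a * v $ a) * (J $ j $ b * v $ b))"
    by (rule sum.cong[OF refl], rule sum.swap)
  also have "\<dots> = (\<Sum>i\<in>UNIV. \<Sum>a\<in>UNIV. \<Sum>b\<in>UNIV. \<Sum>j\<in>UNIV. ?h $ i $ j * (J $ i $ a * v $ a) * (J $ j $ b * v $ b))"
    by (rule sum.swap)
  also have "\<dots> = (\<Sum>i\<in>UNIV. \<Sum>a\<in>UNIV. \<Sum>j\<in>UNIV. \<Sum>b\<in>UNIV. ?h $ i $ j * (J $ i $ a * v $ a) * (J $ j $ b * v $ b))"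
    by (rule sum.cong[OF refl], rule sum.cong[OF refl], rule sum.swap)
  also have "\<dots> = (\<Sum>i\<in>UNIV. \<Sum>j\<in>UNIV. \<Sum>a\<in>UNIV. \<Sum>b\<in>UNIV. ?h $ i $ j * (J $ i $ a * v $ a) * (J $ j $ b * v $ b))"
    by (rule sum.cong[OF refl], rule sum.swap)
  also have "\<dots> = metric_A (g d) (transition c d x, J *v v)"
  proof -
    have "(\<Sum>a\<in>UNIV. \<Sum>b\<in>UNIV. ?h $ i $ j * (J $ i $ a * v $ a) * (J $ j $ b * v $ b))
        = ?h $ i $ j * (J *v v) $ i * (J *v v) $ j" for i j
      by (simp add: matrix_vector_mult_def sum_product mult.assoc) (simp add: sum_distrib_left)
    then show ?thesis by (simp add: metric_A_def p transition_cmap cd)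
  qed
  finally show ?thesis by (simp add: J)
qed

abbreviation "hessian c d p \<equiv> \<lambda>i a e. pd a (\<lambda>y. jacobian_at (transition c d) y $ i $ e) (cmap c p)"

lemma hessian_symmetric:
  "c \<in> \<U> \<Longrightarrow> d \<in> \<U> \<Longrightarrow> p \<in> cdom c \<Longrightarrow> p \<in> cdom d \<Longrightarrow> hessian c d p i a e = hessian c d p i e a"
  by (rule pd_jacobian_at_symmetric[OF open_overlap smooth_transition]) auto

text \<open>The connection transported from \<open>c\<close> is symmetric and leaves
  \<open>L\<close> constant in the chart \<open>d\<close>, so rigidity forces it to be
  \<open>D'\<close>.\<close>

lemma connection_transform:
  assumes cd: "c \<in> \<U>" "d \<in> \<U>" and p: "p \<in> cdom c" "p \<in> cdom d"
    and sym: "\<And>b a e. D b a e = D b e a" "\<And>b a e. D' b a e = D' b e a"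
    and hc: "\<And>v. (cmap c p, v) \<in> local_image \<U> c \<A> \<Longrightarrow> horizontally_constant D (local_rep \<U> c L) (cmap c p, v)"
      "\<And>v. (cmap d p, v) \<in> local_image \<U> d \<A> \<Longrightarrow> horizontally_constant D' (local_rep \<U> d L) (cmap d p, v)"
  shows "D' b a e = transform_connection (jac c d p) (jac d c p) (hessian c d p) D b a e"
proof -
  interpret C: chart_lagrangian "local_rep \<U> c L" "local_image \<U> c \<A>" using cd(1) by (rule chart_lagrangian)
  interpret D: chart_lagrangian "local_rep \<U> d L" "local_image \<U> d \<A>" using cd(2) by (rule chart_lagrangian)
  let ?W = "cmap c ` (cdom c \<inter> cdom d)" and ?x = "cmap c p"
  have x: "?x \<in> ?W" using p by blast
  have hc': "horizontally_constant (transform_connection (jac c d p) (jac d c p) (hessian c d p) D)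
      (local_rep \<U> d L) (cmap d p, u)" if u: "(cmap d p, u) \<in> local_image \<U> d \<A>" for u
  proof -
    \<comment> \<open>The components in \<open>c\<close> of the vector whose components in
      \<open>d\<close> are \<open>u\<close>.\<close>
    define v where "v = jac d c p *v u"
    have v: "(?x, v) \<in> local_image \<U> c \<A>"
      using change_of_chart(1)[OF cd(2,1) u] p cd by (simp add: v_def jac_eq transition_cmap)
    have Jv: "jacobian_at (transition c d) ?x *v v = u"
      by (simp add: v_def jac_eq[symmetric] matrix_vector_mul_assoc jac_inverse[OF cd p])
    have "horizontally_constant
      (transform_connection (jacobian_at (transition c d) ?x) (jac d c p) (hessian c d p) D)
      (local_rep \<U> d L) (transition c d ?x, jacobian_at (transition c d) ?x *v v)"
    \<comment> \<open>The neighbourhood is cut down to base points in the overlap, where the two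
      local expressions can be compared.\<close>
    proof (rule horizontally_constant_transform[where W = ?W and N = "local_image \<U> c \<A> \<inter> ?W \<times> UNIV"
          and f = "local_rep \<U> c L"])
      show "open (local_image \<U> c \<A> \<inter> ?W \<times> UNIV)"
        using C.open_U open_overlap[OF cd] by (simp add: open_Int open_Times)
      show "local_rep \<U> c L (y, w) = local_rep \<U> d L (transition c d y, jacobian_at (transition c d) y *v w)"
        if "(y, w) \<in> local_image \<U> c \<A> \<inter> ?W \<times> UNIV" for y w
        using change_of_chart(2)[OF cd] that by blast
      show "local_rep \<U> d L differentiable at (transition c d ?x, jacobian_at (transition c d) ?x *v v)"
        using smooth_on_differentiable[OF D.smooth u] unfolding Jv by (simp add: transition_cmap cd p)
      show "jacobian_at (transition c d) ?x ** jac d c p = mat 1"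
        using jac_inverse[OF cd p] by (simp add: jac_eq)
    qed (use open_overlap smooth_transition cd x v hc in auto)
    then show ?thesis unfolding Jv by (simp add: jac_eq transition_cmap cd p)
  qed
  obtain u where u: "(cmap d p, u) \<in> local_image \<U> d \<A>"
    using fibre_nonempty[OF cd(2)] p by blast
  show ?thesis
    by (rule D.horizontally_constant_unique[OF sym(2) _ hc(2) hc' u])
      (intro transform_connection_symmetric hessian_symmetric cd p sym(1))
qed

text \<open>The rigidity argument is applied to \<open>A\<close> in place of \<open>L\<close>, which
  avoids differentiating the transformation law of the metric.\<close>

lemma christoffel_transform:
  assumes cd: "c \<in> \<U>" "d \<in> \<U>" and p: "p \<in> cdom c" "p \<in> cdom d"
  shows "christoffel (g d) b a e (cmap d p) = transform_connection (jac c d p) (jac d c p) (hessian c d p)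
    (\<lambda>b a e. christoffel (g c) b a e (cmap c p)) b a e"
proof -
  interpret C: chart_metric "g c" "cmap c ` cdom c" using cd(1) by (rule chart_metric)
  interpret D: chart_metric "g d" "cmap d ` cdom d" using cd(2) by (rule chart_metric)
  let ?W = "cmap c ` (cdom c \<inter> cdom d)" and ?x = "cmap c p"
  have x: "?x \<in> ?W" "?x \<in> cmap c ` cdom c" "cmap d p \<in> cmap d ` cdom d" using p by blast+
  have hc': "horizontally_constant (transform_connection (jac c d p) (jac d c p) (hessian c d p)
      (\<lambda>b a e. christoffel (g c) b a e (cmap c p))) (metric_A (g d)) (cmap d p, u)" for u
  proof -
    define v where "v = jac d c p *v u"
    have Jv: "jacobian_at (transition c d) ?x *v v = u"
      by (simp add: v_def jac_eq[symmetric] matrix_vector_mul_assoc jac_inverse[OF cd p])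
    have "horizontally_constant
      (transform_connection (jacobian_at (transition c d) ?x) (jac d c p) (hessian c d p)
        (\<lambda>b a e. christoffel (g c) b a e (cmap c p)))
      (metric_A (g d)) (transition c d ?x, jacobian_at (transition c d) ?x *v v)"
    proof (rule horizontally_constant_transform[where W = ?W and N = "?W \<times> UNIV" and f = "metric_A (g c)"])
      show "open (?W \<times> (UNIV :: (real^'n) set))"
        using open_overlap[OF cd] by (simp add: open_Times)
      show "metric_A (g c) (y, w) = metric_A (g d) (transition c d y, jacobian_at (transition c d) y *v w)"
        if "(y, w) \<in> ?W \<times> UNIV" for y w
        using metric_A_change_of_chart[OF cd] that by blast
      show "metric_A (g d) differentiable at (transition c d ?x, jacobian_at (transition c d) ?x *v v)"
        using smooth_on_differentiable[OF D.smooth_metric_A] x by (simp add: transition_cmap cd p)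
      show "jacobian_at (transition c d) ?x ** jac d c p = mat 1"
        using jac_inverse[OF cd p] by (simp add: jac_eq)
    qed (use open_overlap smooth_transition cd x C.horizontally_constant_metric_A in auto)
    then show ?thesis unfolding Jv by (simp add: jac_eq transition_cmap cd p)
  qed
  show ?thesis
  \<comment> \<open>Any vector can serve as witness, since \<open>A\<close> is a Lagrangian on whole
    tangent spaces; zero is the simplest.\<close>
  proof (rule D.horizontally_constant_unique[where x = "cmap d p" and v = 0])
    show "transform_connection (jac c d p) (jac d c p) (hessian c d p)
        (\<lambda>b a e. christoffel (g c) b a e (cmap c p)) b a e
      = transform_connection (jac c d p) (jac d c p) (hessian c d p)
        (\<lambda>b a e. christoffel (g c) b a e (cmap c p)) b e a" for b a e
      by (intro transform_connection_symmetric hessian_symmetric cd p C.christoffel_symmetric x)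
  qed (use x hc' D.horizontally_constant_metric_A D.christoffel_symmetric in auto)
qed

section \<open>The Berwald condition and the Cartan connection\<close>

lemma berwald_condition_iff:
  "berwald_condition \<U> \<A> L g T \<longleftrightarrow> (\<forall>c\<in>\<U>. \<forall>(x, v)\<in>local_image \<U> c \<A>.
     horizontally_constant (\<lambda>b a e. christoffel (g c) b a e x + T c x $ b $ a $ e) (local_rep \<U> c L) (x, v))"
proof -
  have "(let \<Omega> = Omega (local_rep \<U> c L) (g c) in
          pdx a \<Omega> (x, v)
            - (\<Sum>b\<in>UNIV. \<Sum>e\<in>UNIV. christoffel (g c) b a e x * v $ e * pdv b \<Omega> (x, v))
          = (\<Sum>b\<in>UNIV. \<Sum>e\<in>UNIV. T c x $ b $ a $ e * v $ e *
               (pdv b \<Omega> (x, v) + 2 * lowered (g c) b (x, v) * \<Omega> (x, v) / metric_A (g c) (x, v))))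
     \<longleftrightarrow> pdx a (local_rep \<U> c L) (x, v) = (\<Sum>b\<in>UNIV. \<Sum>e\<in>UNIV.
          (christoffel (g c) b a e x + T c x $ b $ a $ e) * v $ e * pdv b (local_rep \<U> c L) (x, v))"
    if c: "c \<in> \<U>" and xv: "(x, v) \<in> local_image \<U> c \<A>" for c x v a
  proof -
    interpret C: chart_lagrangian "local_rep \<U> c L" "local_image \<U> c \<A>" using c by (rule chart_lagrangian)
    interpret M: chart_metric "g c" "cmap c ` cdom c" using c by (rule chart_metric)
    show ?thesis
      unfolding Let_def
      by (rule M.Omega_condition_iff[OF local_image_base[OF xv] local_image_nonzero[OF c xv]
            smooth_on_differentiable[OF C.smooth xv]])
  qed
  then show ?thesis
    unfolding berwald_condition_def horizontally_constant_def snd_conv by (simp add: Ball_def split_beta)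
qed

text \<open>Exhibits \<open>\<Gamma> + T\<close> as the linear coefficients of N. Berwald type and
  the spray formula are both read off from this.\<close>

lemma cartan_N_of_berwald_condition:
  assumes T: "lower_symmetric \<U> T" "berwald_condition \<U> \<A> L g T"
    and c: "c \<in> \<U>" and xv: "(x, v) \<in> local_image \<U> c \<A>"
  shows "cartan_N (local_rep \<U> c L) a b (x, v)
    = (\<Sum>e\<in>UNIV. (christoffel (g c) a b e x + T c x $ a $ b $ e) * v $ e)"
proof -
  interpret C: chart_lagrangian "local_rep \<U> c L" "local_image \<U> c \<A>" using c by (rule chart_lagrangian)
  interpret M: chart_metric "g c" "cmap c ` cdom c" using c by (rule chart_metric)
  have x: "x \<in> cmap c ` cdom c" using xv by (rule local_image_base)
  show ?thesis
  proof (rule C.cartan_N_of_horizontally_constant[OF _ _ xv])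
    show "christoffel (g c) a b e x + T c x $ a $ b $ e = christoffel (g c) a e b x + T c x $ a $ e $ b" for a b e
      using T(1) c x M.christoffel_symmetric[OF x] unfolding lower_symmetric_def by metis
    show "horizontally_constant (\<lambda>a b e. christoffel (g c) a b e x + T c x $ a $ b $ e) (local_rep \<U> c L) (x, u)"
      if "(x, u) \<in> local_image \<U> c \<A>" for u
      using T(2) c that unfolding berwald_condition_iff by blast
  qed
qed

lemma berwald_type_of_condition:
  assumes "lower_symmetric \<U> T" "berwald_condition \<U> \<A> L g T"
  shows "berwald_type \<U> \<A> L"
  unfolding berwald_type_def
proof
  fix c assume "c \<in> \<U>"
  then have "\<forall>(x, v)\<in>local_image \<U> c \<A>. \<forall>a b. cartan_N (local_rep \<U> c L) a b (x, v)
      = (\<Sum>e\<in>UNIV. (christoffel (g c) a b e x + T c x $ a $ b $ e) * v $ e)"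
    using cartan_N_of_berwald_condition[OF assms] by (simp add: Ball_def)
  then show "\<exists>\<Xi>. \<forall>(x, v)\<in>local_image \<U> c \<A>. \<forall>a b.
      cartan_N (local_rep \<U> c L) a b (x, v) = (\<Sum>e\<in>UNIV. \<Xi> x a b e * v $ e)"
    by (rule exI[where x = "\<lambda>x a b e. christoffel (g c) a b e x + T c x $ a $ b $ e"])
qed

lemma spray_of_condition:
  assumes "lower_symmetric \<U> T" "berwald_condition \<U> \<A> L g T" "c \<in> \<U>" "(x, v) \<in> local_image \<U> c \<A>"
  shows "spray (local_rep \<U> c L) a (x, v) =
    (1/2) * (\<Sum>b\<in>UNIV. \<Sum>e\<in>UNIV. (christoffel (g c) a b e x + T c x $ a $ b $ e) * v $ b * v $ e)"
  by (simp add: spray_def cartan_N_of_berwald_condition[OF assms] sum_distrib_left sum_distrib_right mult_ac)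

text \<open>Outside the chart images \<open>\<Xi>\<close> is arbitrary, but over them it is
  determined by \<open>L\<close>; symmetry, smoothness and the transformation law of
  \<open>T\<close> all come from this determinacy.\<close>

lemma condition_of_berwald_type:
  assumes "berwald_type \<U> \<A> L"
  shows "\<exists>T. tensor_field_1_2 \<U> T \<and> lower_symmetric \<U> T \<and> berwald_condition \<U> \<A> L g T"
proof -
  obtain \<Xi> where \<Xi>: "\<And>c x v a b. c \<in> \<U> \<Longrightarrow> (x, v) \<in> local_image \<U> c \<A> \<Longrightarrow>
      cartan_N (local_rep \<U> c L) a b (x, v) = (\<Sum>e\<in>UNIV. \<Xi> c x a b e * v $ e)"
    \<comment> \<open>One \<open>\<Xi>\<close> is chosen for each chart, with no relation between
      different charts.\<close>
    using bchoice[OF assms[unfolded berwald_type_def]] by (auto simp: split_beta)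
  have hc: "horizontally_constant (\<Xi> c x) (local_rep \<U> c L) (x, v)"
    if "c \<in> \<U>" "(x, v) \<in> local_image \<U> c \<A>" for c x v
    using chart_lagrangian.horizontally_constant_of_linear_cartan_N[OF chart_lagrangian[OF that(1)]
        local_rep_homogeneous[OF that(1)] \<Xi>[OF that] that(2)] .
  have sym: "\<Xi> c x a b e = \<Xi> c x a e b" if c: "c \<in> \<U>" "x \<in> cmap c ` cdom c" for c x a b e
    using chart_lagrangian.linear_cartan_N_symmetric[OF chart_lagrangian[OF that(1)] \<Xi>[OF that(1)]]
      fibre_nonempty[OF c] by metis
  have smooth: "smooth_on (cmap c ` cdom c) (\<lambda>x. \<Xi> c x a b e)" if c: "c \<in> \<U>" for c a b e
  proof (rule smooth_on_local)
    interpret C: chart_lagrangian "local_rep \<U> c L" "local_image \<U> c \<A>" using c by (rule chart_lagrangian)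
    let ?N = "pdv e (cartan_N (local_rep \<U> c L) a b)"
    fix x assume "x \<in> cmap c ` cdom c"
    then obtain v where v: "(x, v) \<in> local_image \<U> c \<A>" using fibre_nonempty[OF c] by blast
    \<comment> \<open>The fibre vector is frozen at \<open>v\<close>: near \<open>x\<close> the pair
      \<open>(y, v)\<close> stays in the open domain, so \<open>\<Xi>\<close> is a smooth function
      evaluated on an affine slice. Different \<open>x\<close> may need different \<open>v\<close>,
      hence the local form of smoothness.\<close>
    define S where "S = {y. (y, v) \<in> local_image \<U> c \<A>}"
    have "open ((\<lambda>y. (y, v)) -` local_image \<U> c \<A>)"
      using C.open_U by (intro open_vimage continuous_intros)
    then have S: "open S" by (simp add: S_def vimage_def)
    have "bounded_linear (\<lambda>y. (y, 0 :: real^'n))"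
      by (intro bounded_linear_Pair bounded_linear_ident bounded_linear_zero)
    then have "smooth_on S (\<lambda>y. ?N ((y, 0) + (0, v)))"
      by (rule smooth_on_compose_affine[OF _ S smooth_on_pdv[OF C.smooth_cartan_N]]) (simp add: S_def)
    moreover have "\<Xi> c y a b e = ?N ((y, 0) + (0, v))" if "y \<in> S" for y
      using C.linear_cartan_N_coefficients[OF \<Xi>[OF c], of y v] that by (simp add: S_def)
    ultimately have "smooth_on S (\<lambda>y. \<Xi> c y a b e)"
      using smooth_on_cong[OF S, of "\<lambda>y. \<Xi> c y a b e" "\<lambda>y. ?N ((y, 0) + (0, v))"] by blast
    then show "\<exists>S. x \<in> S \<and> open S \<and> smooth_on S (\<lambda>y. \<Xi> c y a b e)"
      using S v by (auto simp: S_def)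
  qed
  define T where "T c x = (\<chi> b a e. \<Xi> c x b a e - christoffel (g c) b a e x)" for c x
  have "tensor_field_1_2 \<U> T"
    unfolding tensor_field_1_2_def
  proof (intro conjI ballI allI)
    fix c assume c: "c \<in> \<U>"
    interpret M: chart_metric "g c" "cmap c ` cdom c" using c by (rule chart_metric)
    show "smooth_on (cmap c ` cdom c) (T c)"
      unfolding T_def[abs_def]
      by (intro smooth_on_vec_lambda smooth_on_diff smooth[OF c] M.smooth_christoffel M.open_V)
  next
    fix c d p b a e
    assume cd: "c \<in> \<U>" "d \<in> \<U>" and "p \<in> cdom c \<inter> cdom d"
    then have p: "p \<in> cdom c" "p \<in> cdom d" by auto
    have "\<Xi> d (cmap d p) b a e
        = transform_connection (jac c d p) (jac d c p) (hessian c d p) (\<Xi> c (cmap c p)) b a e"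
      using cd p by (intro connection_transform) (auto intro!: sym hc)
    then show "T d (cmap d p) $ b $ a $ e = (\<Sum>i\<in>UNIV. \<Sum>j\<in>UNIV. \<Sum>k\<in>UNIV.
        jac c d p $ b $ i * jac d c p $ j $ a * jac d c p $ k $ e * T c (cmap c p) $ i $ j $ k)"
      by (simp add: T_def christoffel_transform[OF cd p] transform_connection_diff)
  qed
  moreover have "lower_symmetric \<U> T"
    unfolding lower_symmetric_def T_def
    using sym chart_metric.christoffel_symmetric[OF chart_metric] by simp
  moreover have "berwald_condition \<U> \<A> L g T"
    unfolding berwald_condition_iff T_def using hc by (auto simp: eta_contract_eq)
  ultimately show ?thesis by blast
qed

end

theorem theorem1:
  fixes X :: "'m topology"
    and \<U> :: "('m, 'n::finite) chart set"
    and L :: "('m, 'n) tvec \<Rightarrow> real"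
    and \<A> :: "('m, 'n) tvec set"
    and g :: "('m, 'n) chart \<Rightarrow> real^'n \<Rightarrow> real^'n^'n"
  assumes "smooth_manifold X \<U>"
    and "finsler_lagrangian \<U> \<A> L"
    and "\<A> \<subseteq> tangent_bundle \<U> - zero_section \<U>"
    and "riemannian_metric \<U> g"
  shows "(berwald_type \<U> \<A> L \<longleftrightarrow>
            (\<exists>T. tensor_field_1_2 \<U> T \<and> lower_symmetric \<U> T \<and> berwald_condition \<U> \<A> L g T)) \<and>
         (berwald_type \<U> \<A> L \<longrightarrow>
            (\<forall>T. tensor_field_1_2 \<U> T \<and> lower_symmetric \<U> T \<and> berwald_condition \<U> \<A> L g T \<longrightarrow>
              (\<forall>c\<in>\<U>. \<forall>(x, v)\<in>local_image \<U> c \<A>. \<forall>a.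
                 spray (local_rep \<U> c L) a (x, v) =
                   (1/2) * (\<Sum>b\<in>UNIV. \<Sum>e\<in>UNIV.
                      (christoffel (g c) a b e x + T c x $ a $ b $ e) * v $ b * v $ e))))"
proof -
  interpret finsler_manifold X \<U> L \<A> g
    by (rule finsler_manifold.intro) (fact assms)+
  show ?thesis
    using condition_of_berwald_type berwald_type_of_condition spray_of_condition by blast
qed

end
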